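(* Let $T$ be a $\{1,3\}$-tree. Then the Ehrhart quasi-polynomial $L^{\mathcal{P}}_T(t)$ has period $2$ and the Ehrhart quasi-polynomial $L^{\mathcal{Q}}_T(t)$ has period $1$.
   Context: A $\{1,3\}$-graph is a finite graph (loops and parallel edges allowed, a loop contributing $2$ to the degree) in which every node has degree $1$ or $3$; degree-$1$ nodes are leaves, degree-$3$ nodes are internal nodes. A $\{1,3\}$-tree is a $\{1,3\}$-graph that is a tree. Let $E$ be the edge set and $I$ the set of internal nodes. For each internal node $v$ let $a,b,c$ be the three edges incident with $v$, listed with multiplicity (a loop at $v$is listed twice). The polytope $\mathcal{P}_G\subset\mathbb{R}^E$ is the set of $w$ satisfying, for every internal node $v$, $w_a\le w_b+w_c$, $w_b\le w_a+w_c$, $w_c\le w_a+w_b$, $w_a+w_b+w_c\le 1$, together with $0\le w_e\le \frac12$ for every edge $e$ that alone forms a connected component. The polytope $\mathcal{Q}_G\subset\mathbb{R}^E\times\mathbb{R}^I$ is the set of $(w,z)$ satisfying, for every internal node $v$, the same three triangle inequalities, $w_a+w_b+w_c=2z_v$ and $z_v\le 1$, together with $0\le w_e\le 1$ for every edge $e$ that alone forms a component. For an integer $t\ge 0$, $L^{\mathcal{P}}_G(t)=|t\mathcal{P}_G\cap\mathbb{Z}^E|$ and $L^{\mathcal{Q}}_G(t)=|t\mathcal{Q}_G\cap(\mathbb{Z}^E\times\mathbb{Z}^I)|$. These are quasi-polynomials in $t$: there are polynomials $p_0,\dots,p_{\alpha-1}$ with $L(t)=p_j(t)$ whenever $t\equiv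 j \pmod \alpha$; the least such $\alpha$ is the period. *)

theory Defs
  imports
    Complex_Main
    "HOL-Library.Multiset"
    "HOL-Library.FuncSet"
    "HOL-Computational_Algebra.Polynomial"
begin

text \<open>Undirected multigraphs. The ends of an edge form a two-element multiset of nodes,
  so that a loop at \<open>v\<close> has ends \<open>{#v, v#}\<close> and is counted twice at \<open>v\<close>.\<close>

record ('v, 'e) mgraph =
  nodes :: "'v set"
  edges :: "'e set"
  ends :: "'e \<Rightarrow> 'v multiset"

definition finite_mgraph :: "('v, 'e) mgraph \<Rightarrow> bool" where
  "finite_mgraph G \<longleftrightarrow> finite (nodes G) \<and> finite (edges G) \<and>
     (\<forall>e\<in>edges G. size (ends G e) = 2 \<and> set_mset (ends G e) \<subseteq> nodes G)"

definition incident_edges :: "('v, 'e) mgraph \<Rightarrow> 'v \<Rightarrow> 'e multiset" where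
  "incident_edges G v = (\<Sum>e\<in>edges G. replicate_mset (count (ends G e) v) e)"

definition node_degree :: "('v, 'e) mgraph \<Rightarrow> 'v \<Rightarrow> nat" where
  "node_degree G v = size (incident_edges G v)"

definition graph13 :: "('v, 'e) mgraph \<Rightarrow> bool" where
  "graph13 G \<longleftrightarrow> finite_mgraph G \<and> (\<forall>v\<in>nodes G. node_degree G v = 1 \<or> node_degree G v = 3)"

definition internal_nodes :: "('v, 'e) mgraph \<Rightarrow> 'v set" where
  "internal_nodes G = {v \<in> nodes G. node_degree G v = 3}"

definition adjacency :: "('v, 'e) mgraph \<Rightarrow> ('v \<times> 'v) set" where
  "adjacency G = {(u, v). \<exists>e\<in>edges G. ends G e = {#u, v#}}"

definition connected_mgraph :: "('v, 'e) mgraph \<Rightarrow> bool" where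
  "connected_mgraph G \<longleftrightarrow> nodes G \<noteq> {} \<and> (\<forall>u\<in>nodes G. \<forall>v\<in>nodes G. (u, v) \<in> (adjacency G)\<^sup>*)"

text \<open>A loop is a cycle of length 1, and two parallel edges form a cycle of length 2.\<close>

definition cycle_in :: "('v, 'e) mgraph \<Rightarrow> 'v list \<Rightarrow> 'e list \<Rightarrow> bool" where
  "cycle_in G vs es \<longleftrightarrow> vs \<noteq> [] \<and> length es = length vs \<and> distinct vs \<and> distinct es \<and>
     set vs \<subseteq> nodes G \<and> set es \<subseteq> edges G \<and>
     (\<forall>i<length vs. ends G (es ! i) = {#vs ! i, vs ! (Suc i mod length vs)#})"

definition tree_mgraph :: "('v, 'e) mgraph \<Rightarrow> bool" where
  "tree_mgraph G \<longleftrightarrow> connected_mgraph G \<and> (\<nexists>vs es. cycle_in G vs es)"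

definition tree13 :: "('v, 'e) mgraph \<Rightarrow> bool" where
  "tree13 G \<longleftrightarrow> graph13 G \<and> tree_mgraph G"

definition component_edges :: "('v, 'e) mgraph \<Rightarrow> 'e \<Rightarrow> 'e set" where
  "component_edges G e =
     {f \<in> edges G. \<exists>u v. u \<in># ends G e \<and> v \<in># ends G f \<and> (u, v) \<in> (adjacency G)\<^sup>*}"

definition single_edge_components :: "('v, 'e) mgraph \<Rightarrow> 'e set" where
  "single_edge_components G = {e \<in> edges G. component_edges G e = {e}}"

text \<open>The space \<open>\<real>\<^sup>A\<close> is represented by the extensional functions \<open>A \<rightarrow>\<^sub>E UNIV\<close>,
  and the lattice \<open>\<int>\<^sup>A\<close> by \<open>A \<rightarrow>\<^sub>E \<int>\<close>.\<close>

definition polytope_P :: "('v, 'e) mgraph \<Rightarrow> ('e \<Rightarrow> real) set" where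
  "polytope_P G = {w \<in> edges G \<rightarrow>\<^sub>E UNIV.
     (\<forall>v\<in>internal_nodes G. \<forall>a b c. incident_edges G v = {#a, b, c#} \<longrightarrow>
        w a \<le> w b + w c \<and> w b \<le> w a + w c \<and> w c \<le> w a + w b \<and> w a + w b + w c \<le> 1) \<and>
     (\<forall>e\<in>single_edge_components G. 0 \<le> w e \<and> w e \<le> 1 / 2)}"

definition polytope_Q :: "('v, 'e) mgraph \<Rightarrow> (('e \<Rightarrow> real) \<times> ('v \<Rightarrow> real)) set" where
  "polytope_Q G = {(w, z) \<in> (edges G \<rightarrow>\<^sub>E UNIV) \<times> (internal_nodes G \<rightarrow>\<^sub>E UNIV).
     (\<forall>v\<in>internal_nodes G. \<forall>a b c. incident_edges G v = {#a, b, c#} \<longrightarrow>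
        w a \<le> w b + w c \<and> w b \<le> w a + w c \<and> w c \<le> w a + w b \<and>
        w a + w b + w c = 2 * z v \<and> z v \<le> 1) \<and>
     (\<forall>e\<in>single_edge_components G. 0 \<le> w e \<and> w e \<le> 1)}"

definition scale_on :: "'a set \<Rightarrow> real \<Rightarrow> ('a \<Rightarrow> real) \<Rightarrow> 'a \<Rightarrow> real" where
  "scale_on A r w = (\<lambda>x\<in>A. r * w x)"

definition ehrhart_P :: "('v, 'e) mgraph \<Rightarrow> nat \<Rightarrow> nat" where
  "ehrhart_P G t = card (scale_on (edges G) (real t) ` polytope_P G \<inter> (edges G \<rightarrow>\<^sub>E \<int>))"

definition ehrhart_Q :: "('v, 'e) mgraph \<Rightarrow> nat \<Rightarrow> nat" where
  "ehrhart_Q G t =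
     card (map_prod (scale_on (edges G) (real t)) (scale_on (internal_nodes G) (real t)) ` polytope_Q G
           \<inter> ((edges G \<rightarrow>\<^sub>E \<int>) \<times> (internal_nodes G \<rightarrow>\<^sub>E \<int>)))"

definition quasi_polynomial_mod :: "nat \<Rightarrow> (nat \<Rightarrow> nat) \<Rightarrow> bool" where
  "quasi_polynomial_mod m L \<longleftrightarrow> m > 0 \<and>
     (\<exists>p :: nat \<Rightarrow> real poly. \<forall>j<m. \<forall>t. t mod m = j \<longrightarrow> real (L t) = poly (p j) (real t))"

text \<open>\<open>L\<close> is a quasi-polynomial whose (least) period is \<open>m\<close>.\<close>

definition has_period :: "(nat \<Rightarrow> nat) \<Rightarrow> nat \<Rightarrow> bool" where
  "has_period L m \<longleftrightarrow> quasi_polynomial_mod m L \<and> (\<forall>k. quasi_polynomial_mod k L \<longrightarrow> m \<le> k)"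

end

theory Submission
  imports Defs
begin

text \<open>
  Root the tree at a leaf. A lattice point of \<open>t Q\<close> is an edge labelling by \<open>0, \<dots>, t\<close> whose labels
  \<open>k, a, b\<close> at each internal node satisfy the triangle inequalities, have even sum, and have sum at
  most \<open>2 t\<close>. For fixed \<open>k\<close> the admissible pairs are \<open>a = s + d\<close>, \<open>b = s + k - d\<close> with
  \<open>0 \<le> s \<le> t - k\<close> and \<open>0 \<le> d \<le> k\<close>; hence, by induction on the tree, the number of labellings with
  root label \<open>k\<close> is a polynomial in \<open>(t, k)\<close>, and summing over \<open>k\<close> shows that \<open>L\<^sup>Q\<close> is a polynomial.
  For even \<open>t\<close> the same argument, with one more family of pairs for odd sums, applies to \<open>L\<^sup>P\<close>.

  Doubling identifies lattice points of \<open>t P\<close> with the labellings counted by \<open>L\<^sup>Q(t)\<close> all of whose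
  labels are even. For odd \<open>t\<close> the symmetry \<open>a \<mapsto> t - a\<close> of the node condition (applied to two labels)
  reverses parity and gives \<open>L\<^sup>Q(t) = 2\<^sup>n\<^sup>+\<^sup>1 L\<^sup>P(t)\<close>, where \<open>n\<close> is the number of internal nodes. So \<open>L\<^sup>P\<close>
  is a polynomial on odd \<open>t\<close> as well; it is not one polynomial, since \<open>L\<^sup>P(0) = L\<^sup>Q(0) = 1\<close>.
\<close>

subsection \<open>Polynomial functions and summation\<close>

text \<open>Polynomial functions of variables indexed by \<open>nat\<close>. Multiplication by a variable instead of
  general products as a generator lets the summation lemma below go through by rule induction.\<close>

inductive polyfun :: "((nat \<Rightarrow> real) \<Rightarrow> real) \<Rightarrow> bool" where
  polyfun_const: "polyfun (\<lambda>x. c)"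
| polyfun_add: "polyfun F \<Longrightarrow> polyfun G \<Longrightarrow> polyfun (\<lambda>x. F x + G x)"
| polyfun_var_mult: "polyfun F \<Longrightarrow> polyfun (\<lambda>x. x i * F x)"

lemma polyfun_var: "polyfun (\<lambda>x. x i)"
  using polyfun_var_mult[OF polyfun_const[of 1], of i] by simp

lemma polyfun_cmult: "polyfun F \<Longrightarrow> polyfun (\<lambda>x. c * F x)"
proof (induction rule: polyfun.induct)
  case (polyfun_var_mult F i)
  then show ?case
    using polyfun.polyfun_var_mult[OF polyfun_var_mult.IH, of i] by (simp add: mult.left_commute)
qed (auto intro: polyfun.intros simp: distrib_left)

lemma polyfun_mult: "polyfun F \<Longrightarrow> polyfun G \<Longrightarrow> polyfun (\<lambda>x. F x * G x)"
proof (induction rule: polyfun.induct)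
  case (polyfun_const c)
  then show ?case by (rule polyfun_cmult)
next
  case (polyfun_add F F')
  then show ?case by (auto intro: polyfun.intros simp: distrib_right)
next
  case (polyfun_var_mult F i)
  then show ?case
    using polyfun.polyfun_var_mult[of "\<lambda>x. F x * G x" i] by (simp add: mult.assoc)
qed

lemma polyfun_diff: "polyfun F \<Longrightarrow> polyfun G \<Longrightarrow> polyfun (\<lambda>x. F x - G x)"
  using polyfun_add[of F "\<lambda>x. - 1 * G x"] polyfun_cmult[of G "-1"] by simp

lemma polyfun_poly: "polyfun F \<Longrightarrow> polyfun (\<lambda>x. poly p (F x))"
  by (induction p) (auto intro: polyfun_const polyfun_add polyfun_mult)

lemma polyfun_subst: "polyfun F \<Longrightarrow> (\<And>i. polyfun (g i)) \<Longrightarrow> polyfun (\<lambda>x. F (\<lambda>i. g i x))"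
  by (induction rule: polyfun.induct) (auto intro: polyfun_const polyfun_add polyfun_mult)

text \<open>Pulls a polynomial function of several variables back along a polynomial curve; this is
  how the total count becomes a value of \<open>poly\<close>.\<close>

lemma polyfun_univariate:
  assumes "polyfun F"
  shows "\<exists>p. \<forall>y. F (\<lambda>i. poly (q i) y) = poly p y"
  using assms
proof (induction rule: polyfun.induct)
  case (polyfun_const c)
  show ?case by (rule exI[of _ "[:c:]"]) simp
next
  case (polyfun_add F G)
  then show ?case by (metis poly_add)
next
  case (polyfun_var_mult F i)
  then show ?case by (metis poly_mult)
qed

text \<open>Telescoping \<open>(d + 1) ^ Suc j - d ^ Suc j\<close> and expanding by the binomial
  theorem expresses \<open>n ^ Suc j\<close> through the power sums of exponents up to
  \<open>j\<close>. The sum of exponent \<open>j\<close> enters with the nonzero factor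
  \<open>Suc j\<close>, so it can be solved for.\<close>

lemma power_sum_poly: "\<exists>p :: real poly. \<forall>n. (\<Sum>d<n. real d ^ j) = poly p (real n)"
proof (induction j rule: less_induct)
  case (less j)
  then obtain S :: "nat \<Rightarrow> real poly"
    where S: "\<And>i n. i < j \<Longrightarrow> (\<Sum>d<n. real d ^ i) = poly (S i) (real n)"
    by metis
  define p where
    "p = smult (1 / real (Suc j)) (monom 1 (Suc j) - (\<Sum>i<j. smult (real (Suc j choose i)) (S i)))"
  have "(\<Sum>d<n. real d ^ j) = poly p (real n)" for n
  proof -
    have step: "real (Suc d) ^ Suc j - real d ^ Suc j
        = (\<Sum>i<j. real (Suc j choose i) * real d ^ i) + real (Suc j) * real d ^ j" for d
    proof -
      have "(real d + 1) ^ Suc j = (\<Sum>i\<le>Suc j. real (Suc j choose i) * real d ^ i)"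
        by (subst binomial_ring) simp
      also have "\<dots> = (\<Sum>i<j. real (Suc j choose i) * real d ^ i) + real (Suc j) * real d ^ j + real d ^ Suc j"
        by (simp add: lessThan_Suc_atMost[symmetric] del: binomial_Suc_Suc)
      finally show ?thesis by (simp add: add.commute)
    qed
    have "real n ^ Suc j = (\<Sum>d<n. real (Suc d) ^ Suc j - real d ^ Suc j)"
      by (subst sum_lessThan_telescope) simp
    also have "\<dots> = (\<Sum>i<j. real (Suc j choose i) * poly (S i) (real n)) + real (Suc j) * (\<Sum>d<n. real d ^ j)"
      unfolding step sum.distrib by (subst sum.swap) (simp add: sum_distrib_left[symmetric] S del: binomial_Suc_Suc)
    finally have "real (Suc j) * (\<Sum>d<n. real d ^ j)
        = real n ^ Suc j - (\<Sum>i<j. real (Suc j choose i) * poly (S i) (real n))"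
      by simp
    then show ?thesis
      unfolding p_def by (simp add: poly_sum poly_monom field_simps del: binomial_Suc_Suc power_Suc of_nat_Suc)
  qed
  then show ?case by blast
qed

text \<open>The weight \<open>d ^ j\<close> lets the induction close: a factor equal to the
  summation variable raises \<open>j\<close> by one, while any other variable is constant in the sum
  and is pulled out.\<close>

lemma polyfun_sum_power:
  assumes "polyfun F"
  shows "\<exists>H. polyfun H \<and> (\<forall>x n. (\<Sum>d<n. real d ^ j * F (x(i := real d))) = H (x(i := real n)))"
  using assms
proof (induction arbitrary: j rule: polyfun.induct)
  case (polyfun_const c)
  obtain p where p: "\<forall>n. (\<Sum>d<n. real d ^ j) = poly p (real n)"
    using power_sum_poly[of j] by blast
  have "polyfun (\<lambda>x. poly p (x i) * c)"
    by (intro polyfun_mult polyfun_poly polyfun_var polyfun.polyfun_const)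
  then show ?case
    using p by (intro exI[of _ "\<lambda>x. poly p (x i) * c"]) (simp add: sum_distrib_right[symmetric])
next
  case (polyfun_add F G)
  obtain H where H: "polyfun H" "\<forall>x n. (\<Sum>d<n. real d ^ j * F (x(i := real d))) = H (x(i := real n))"
    using polyfun_add.IH(1) by blast
  obtain K where K: "polyfun K" "\<forall>x n. (\<Sum>d<n. real d ^ j * G (x(i := real d))) = K (x(i := real n))"
    using polyfun_add.IH(2) by blast
  show ?case
    using H K polyfun.polyfun_add[of H K]
    by (intro exI[of _ "\<lambda>x. H x + K x"]) (simp add: distrib_left sum.distrib del: fun_upd_apply)
next
  case (polyfun_var_mult F i')
  show ?case
  proof (cases "i' = i")
    case True
    obtain H where "polyfun H" "\<forall>x n. (\<Sum>d<n. real d ^ Suc j * F (x(i := real d))) = H (x(i := real n))"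
      using polyfun_var_mult.IH by blast
    then show ?thesis
      using True by (intro exI[of _ H]) (simp add: mult.assoc mult.left_commute fun_upd_def)
  next
    case False
    obtain H where H: "polyfun H" "\<forall>x n. (\<Sum>d<n. real d ^ j * F (x(i := real d))) = H (x(i := real n))"
      using polyfun_var_mult.IH by blast
    then show ?thesis
      using False polyfun.polyfun_var_mult[of H i']
      by (intro exI[of _ "\<lambda>x. x i' * H x"]) (simp add: mult.left_commute sum_distrib_left[symmetric] fun_upd_def)
  qed
qed

text \<open>Substituting \<open>N\<close> for variable \<open>i\<close> in the closed form for a
  numerical bound handles a bound that is itself polynomial. The identity is claimed only at points
  where \<open>N\<close> takes a natural value.\<close>

lemma polyfun_sum:
  assumes "polyfun F" "polyfun N"
  shows "\<exists>H. polyfun H \<and> (\<forall>x n. N x = real n \<longrightarrow> (\<Sum>d<n. F (x(i := real d))) = H x)"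
proof -
  obtain H where H: "polyfun H" "\<forall>x n. (\<Sum>d<n. F (x(i := real d))) = H (x(i := real n))"
    using polyfun_sum_power[OF assms(1), of 0 i] by auto
  have "polyfun (\<lambda>x. H (\<lambda>l. (if l = i then N else (\<lambda>x. x l)) x))"
    by (rule polyfun_subst[OF H(1)]) (auto intro: assms polyfun_var)
  moreover have "(\<lambda>l. (if l = i then N else (\<lambda>x. x l)) x) = x(i := N x)" for x
    by auto
  ultimately have "polyfun (\<lambda>x. H (x(i := N x)))" by simp
  with H(2) show ?thesis by (intro exI[of _ "\<lambda>x. H (x(i := N x))"]) auto
qed

subsection \<open>Counting labellings of rooted binary trees\<close>

datatype shape = Leaf | Node shape shape

text \<open>\<open>count_shape R M s k\<close> counts the labellings in \<open>{..M}\<close> of the edges of a rooted binary tree of shape \<open>s\<close>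
  (a pending edge hangs at the root) with root label \<open>k\<close> and with \<open>R\<close> holding at every internal node.\<close>

primrec count_shape :: "(nat multiset \<Rightarrow> bool) \<Rightarrow> nat \<Rightarrow> shape \<Rightarrow> nat \<Rightarrow> nat" where
  "count_shape R M Leaf k = 1"
| "count_shape R M (Node l r) k =
     (\<Sum>(a, b) \<in> {(a, b). a \<le> M \<and> b \<le> M \<and> R {#k, a, b#}}. count_shape R M l a * count_shape R M r b)"

text \<open>On three entries, bounding twice each entry by the total is the triple of triangle
  inequalities. The multiset form needs no ordering of the edges at a node.\<close>

definition tri_P :: "nat \<Rightarrow> nat multiset \<Rightarrow> bool" where
  "tri_P t m \<longleftrightarrow> (\<forall>a\<in>#m. 2 * a \<le> \<Sum>\<^sub># m) \<and> \<Sum>\<^sub># m \<le> t"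

text \<open>The coordinate \<open>z\<close> of a node is eliminated: it is half the total, so its
  integrality becomes evenness and its bound \<open>t\<close> becomes \<open>2 * t\<close>.\<close>

definition tri_Q :: "nat \<Rightarrow> nat multiset \<Rightarrow> bool" where
  "tri_Q t m \<longleftrightarrow> (\<forall>a\<in>#m. 2 * a \<le> \<Sum>\<^sub># m) \<and> even (\<Sum>\<^sub># m) \<and> \<Sum>\<^sub># m \<le> 2 * t"

text \<open>The label bounds \<open>t div 2\<close> and \<open>t\<close> come from the condition on
  an edge that forms a component; at an internal node they follow from the triangle inequalities and
  the bound on the total.\<close>

abbreviation count_P where "count_P t \<equiv> count_shape (tri_P t) (t div 2)"
abbreviation count_Q where "count_Q t \<equiv> count_shape (tri_Q t) t"

lemma tri_P_triple: "tri_P t {#a, b, c#} \<longleftrightarrow> a \<le> b + c \<and> b \<le> a + c \<and> c \<le> a + b \<and> a + b + c \<le> t"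
  by (auto simp: tri_P_def)

lemma tri_Q_triple:
  "tri_Q t {#a, b, c#} \<longleftrightarrow> a \<le> b + c \<and> b \<le> a + c \<and> c \<le> a + b \<and> even (a + b + c) \<and> a + b + c \<le> 2 * t"
  by (auto simp: tri_Q_def)

section \<open>Parametrisation of the pairs admissible at a node with given upper label\<close>

lemma finite_pairs: "finite {(a, b). a \<le> (M::nat) \<and> b \<le> M \<and> R a b}"
  by (rule finite_subset[of _ "{..M} \<times> {..M}"]) auto

text \<open>The parameters are \<open>s = (a + b - k) / 2\<close> and
  \<open>d = (a + k - b) / 2\<close>, integers because the total is even. The triangle inequalities
  say that \<open>s\<close>, \<open>d\<close> and \<open>k - d\<close> are nonnegative, and the
  total is \<open>2 * (s + k)\<close>, whence \<open>s + k \<le> m\<close>.\<close>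

lemma even_triangles_image:
  assumes "k \<le> (m::nat)"
  shows "{(a, b). a \<le> m \<and> b \<le> m \<and> tri_Q m {#k, a, b#}}
    = (\<lambda>(s, d). (s + d, s + (k - d))) ` ({..<m - k + 1} \<times> {..<k + 1})" (is "?S = ?f ` ?D")
proof (intro equalityI subsetI)
  fix p assume "p \<in> ?S"
  then obtain a b where p: "p = (a, b)" "k \<le> a + b" "b \<le> k + a" "a \<le> k + b" "k + a + b \<le> 2 * m"
    and ev: "even (k + a + b)"
    by (auto simp: tri_Q_triple)
  have "even (a + b - k)" "even (a + k - b)" using ev p by auto
  then obtain s d where "a + b - k = 2 * s" "a + k - b = 2 * d" by (meson evenE)
  with p have sd: "a + b = k + 2 * s" "a + k = b + 2 * d" by auto
  with p assms have "(s, d) \<in> ?D" "p = ?f (s, d)" by auto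
  then show "p \<in> ?f ` ?D" by blast
next
  fix p assume "p \<in> ?f ` ?D"
  then obtain s d where "p = (s + d, s + (k - d))" "s \<le> m - k" "d \<le> k" by auto
  moreover define c where "c = k - d"
  ultimately have p: "p = (s + d, s + c)" "s + k \<le> m" "k = c + d" using assms by auto
  then show "p \<in> ?S" by (auto simp: tri_Q_triple)
qed

text \<open>For an odd total the same parameters are half-integers and are rounded down. The
  inequalities then become strict, so both ranges lose one element against the even case.\<close>

lemma odd_triangles_image:
  assumes "k \<le> (m::nat)"
  shows "{(a, b). a \<le> m \<and> b \<le> m \<and> tri_P (2 * m) {#k, a, b#} \<and> odd (k + a + b)}
    = (\<lambda>(s, d). (s + d + 1, s + (k - d))) ` ({..<m - k} \<times> {..<k})" (is "?S = ?f ` ?D")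
proof (intro equalityI subsetI)
  fix p assume "p \<in> ?S"
  then obtain a b where p: "p = (a, b)" "k \<le> a + b" "b \<le> k + a" "a \<le> k + b" "k + a + b \<le> 2 * m"
    and ev: "odd (k + a + b)"
    by (auto simp: tri_P_triple)
  have "odd (a + b - k)" "odd (a + k - b)" using ev p by auto
  then obtain s d where "a + b - k = 2 * s + 1" "a + k - b = 2 * d + 1" by (meson oddE)
  with p have sd: "a + b = k + 2 * s + 1" "a + k = b + 2 * d + 1" by auto
  \<comment> \<open>An odd total misses the bound \<open>2 * m\<close>, which yields the strict
    inequality \<open>s + k < m\<close>.\<close>
  moreover have "k + a + b \<noteq> 2 * m" using ev by (metis dvd_triv_left)
  ultimately have "(s, d) \<in> ?D" "p = ?f (s, d)" using p by auto
  then show "p \<in> ?f ` ?D" by blast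
next
  fix p assume "p \<in> ?f ` ?D"
  then obtain s d where "p = (s + d + 1, s + (k - d))" "s < m - k" "d < k" by auto
  moreover define c where "c = k - d"
  ultimately have p: "p = (s + d + 1, s + c)" "s + k < m" "k = c + d" "c > 0" using assms by auto
  then show "p \<in> ?S" by (auto simp: tri_P_triple)
qed

lemma sum_even_triangles:
  assumes "k \<le> (m::nat)"
  shows "(\<Sum>(a, b) \<in> {(a, b). a \<le> m \<and> b \<le> m \<and> tri_Q m {#k, a, b#}}. f a * g b)
    = (\<Sum>s<m - k + 1. \<Sum>d<k + 1. f (s + d) * (g (s + (k - d)) :: nat))"
  unfolding even_triangles_image[OF assms] sum.cartesian_product
  by (subst sum.reindex) (auto simp: inj_on_def case_prod_unfold intro!: sum.cong)

lemma sum_odd_triangles: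
  assumes "k \<le> (m::nat)"
  shows "(\<Sum>(a, b) \<in> {(a, b). a \<le> m \<and> b \<le> m \<and> tri_P (2 * m) {#k, a, b#} \<and> odd (k + a + b)}. f a * g b)
    = (\<Sum>s<m - k. \<Sum>d<k. f (s + d + 1) * (g (s + (k - d)) :: nat))"
  unfolding odd_triangles_image[OF assms] sum.cartesian_product
  by (subst sum.reindex) (auto simp: inj_on_def case_prod_unfold intro!: sum.cong)

lemma count_Q_Node:
  assumes "k \<le> t"
  shows "count_Q t (Node l r) k = (\<Sum>s<t - k + 1. \<Sum>d<k + 1. count_Q t l (s + d) * count_Q t r (s + (k - d)))"
  unfolding count_shape.simps by (rule sum_even_triangles[OF assms])

text \<open>The triples with even total that satisfy \<open>tri_P (2 * m)\<close> are exactly those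
  satisfying \<open>tri_Q m\<close>; splitting by the parity of the total therefore gives the two
  parametrised sums.\<close>

lemma count_P_even_Node:
  assumes "k \<le> m"
  shows "count_P (2 * m) (Node l r) k =
      (\<Sum>s<m - k + 1. \<Sum>d<k + 1. count_P (2 * m) l (s + d) * count_P (2 * m) r (s + (k - d)))
    + (\<Sum>s<m - k. \<Sum>d<k. count_P (2 * m) l (s + d + 1) * count_P (2 * m) r (s + (k - d)))"
proof -
  let ?f = "\<lambda>(a, b). count_P (2 * m) l a * count_P (2 * m) r b"
  let ?E = "{(a, b). a \<le> m \<and> b \<le> m \<and> tri_Q m {#k, a, b#}}"
  let ?O = "{(a, b). a \<le> m \<and> b \<le> m \<and> tri_P (2 * m) {#k, a, b#} \<and> odd (k + a + b)}"
  have "{(a, b). a \<le> m \<and> b \<le> m \<and> tri_P (2 * m) {#k, a, b#}} = ?E \<union> ?O"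
    by (auto simp: tri_P_triple tri_Q_triple)
  then have "count_P (2 * m) (Node l r) k = sum ?f (?E \<union> ?O)"
    by simp
  also have "\<dots> = sum ?f ?E + sum ?f ?O"
    by (rule sum.union_disjoint) (auto intro: finite_pairs simp: tri_Q_triple)
  finally show ?thesis
    unfolding sum_even_triangles[OF assms] sum_odd_triangles[OF assms] .
qed

text \<open>A function of two variables \<open>(m, k)\<close> is evaluated at the point \<open>(\<lambda>_. k)(0 := m)\<close>.
  The parameter \<open>n\<close> distinguishes the even (\<open>n = 1\<close>) and the odd (\<open>n = 0\<close>) triangles.\<close>

lemma double_sum_polyfun:
  assumes F: "polyfun F1" "polyfun F2" and n: "n \<le> 1"
  shows "\<exists>H. polyfun H \<and> (\<forall>m k f g. k \<le> m \<longrightarrow>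
      (\<forall>a\<le>m. real (f a) = F1 ((\<lambda>_. real a)(0 := real m))) \<longrightarrow>
      (\<forall>a\<le>m. real (g a) = F2 ((\<lambda>_. real a)(0 := real m))) \<longrightarrow>
      real (\<Sum>s<m - k + n. \<Sum>d<k + n. f (s + d + (1 - n)) * g (s + (k - d)))
        = H ((\<lambda>_. real k)(0 := real m)))"
proof -
  \<comment> \<open>Coordinates 0, 1, 2, 3 of \<open>x\<close> stand for \<open>m\<close>,
    \<open>k\<close>, \<open>s\<close>, \<open>d\<close>. The summand is then a polynomial function,
    to be summed over coordinate 3 and afterwards over coordinate 2.\<close>
  define G where "G x = F1 (\<lambda>j. (if j = 0 then (\<lambda>x. x 0) else (\<lambda>x. x 2 + x 3 + real (1 - n))) x)
      * F2 (\<lambda>j. (if j = 0 then (\<lambda>x. x 0) else (\<lambda>x. x 2 + (x 1 - x 3))) x)" for x :: "nat \<Rightarrow> real"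
  have "polyfun G" unfolding G_def
    by (intro polyfun_mult polyfun_subst[OF F(1)] polyfun_subst[OF F(2)])
      (auto intro!: polyfun_add polyfun_diff polyfun_var polyfun_const)
  moreover have "polyfun (\<lambda>x. x 1 + real n)" by (intro polyfun_add polyfun_var polyfun_const)
  ultimately obtain H1 where H1: "polyfun H1"
    "\<And>x n'. x 1 + real n = real n' \<Longrightarrow> (\<Sum>d<n'. G (x(3 := real d))) = H1 x"
    using polyfun_sum[of G "\<lambda>x. x 1 + real n" 3] by blast
  have "polyfun (\<lambda>x. x 0 - x 1 + real n)"
    by (intro polyfun_add polyfun_diff polyfun_var polyfun_const)
  with H1(1) obtain H2 where H2: "polyfun H2"
    "\<And>x n'. x 0 - x 1 + real n = real n' \<Longrightarrow> (\<Sum>s<n'. H1 (x(2 := real s))) = H2 x"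
    using polyfun_sum[of H1 "\<lambda>x. x 0 - x 1 + real n" 2] by blast
  have "real (\<Sum>s<m - k + n. \<Sum>d<k + n. f (s + d + (1 - n)) * g (s + (k - d))) = H2 ((\<lambda>_. real k)(0 := real m))"
    if k: "k \<le> m"
      and f: "\<forall>a\<le>m. real (f a) = F1 ((\<lambda>_. real a)(0 := real m))"
      and g: "\<forall>a\<le>m. real (g a) = F2 ((\<lambda>_. real a)(0 := real m))" for m k f g
  proof -
    define x :: "nat \<Rightarrow> real" where "x = (\<lambda>_. real k)(0 := real m)"
    have "real (f (s + d + (1 - n)) * g (s + (k - d))) = G (x(2 := real s, 3 := real d))"
      if "s < m - k + n" "d < k + n" for s d
    proof -
      \<comment> \<open>The first bound makes natural and real subtraction agree in
        \<open>k - d\<close>; the other two place the arguments of \<open>f\<close> and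
        \<open>g\<close> in the range where their formulas are assumed.\<close>
      have le: "d \<le> k" "s + d + (1 - n) \<le> m" "s + (k - d) \<le> m" using that k n by auto
      have "(\<lambda>j::nat. (if j = 0 then (\<lambda>x. x 0) else (\<lambda>x. x 2 + x 3 + real (1 - n))) (x(2 := real s, 3 := real d)))
          = (\<lambda>_. real (s + d + (1 - n)))(0 := real m)"
        by (auto simp: x_def)
      moreover have "(\<lambda>j::nat. (if j = 0 then (\<lambda>x. x 0) else (\<lambda>x. x 2 + (x 1 - x 3))) (x(2 := real s, 3 := real d)))
          = (\<lambda>_. real (s + (k - d)))(0 := real m)"
        using le(1) by (auto simp: x_def of_nat_diff)
      ultimately show ?thesis
        using f[rule_format, OF le(2)] g[rule_format, OF le(3)] by (simp only: G_def of_nat_mult)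
    qed
    then have "real (\<Sum>s<m - k + n. \<Sum>d<k + n. f (s + d + (1 - n)) * g (s + (k - d)))
        = (\<Sum>s<m - k + n. \<Sum>d<k + n. G (x(2 := real s, 3 := real d)))"
      unfolding of_nat_sum by (intro sum.cong refl) auto
    also have "\<dots> = (\<Sum>s<m - k + n. H1 (x(2 := real s)))"
      by (intro sum.cong refl H1(2)) (simp add: x_def)
    also have "\<dots> = H2 x"
      by (rule H2(2)) (use k in \<open>simp add: x_def of_nat_diff\<close>)
    finally show ?thesis unfolding x_def .
  qed
  with H2(1) show ?thesis by blast
qed

lemma count_Q_polyfun:
  "\<exists>F. polyfun F \<and> (\<forall>t. \<forall>k\<le>t. real (count_Q t s k) = F ((\<lambda>_. real k)(0 := real t)))"
proof (induction s)
  case Leaf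
  show ?case using polyfun_const[of 1] by auto
next
  case (Node l r)
  then obtain F1 F2 where F: "polyfun F1" "polyfun F2"
    "\<And>t k. k \<le> t \<Longrightarrow> real (count_Q t l k) = F1 ((\<lambda>_. real k)(0 := real t))"
    "\<And>t k. k \<le> t \<Longrightarrow> real (count_Q t r k) = F2 ((\<lambda>_. real k)(0 := real t))"
    by metis
  obtain H where "polyfun H" and H: "\<And>m k f g. k \<le> m \<Longrightarrow>
      (\<forall>a\<le>m. real (f a) = F1 ((\<lambda>_. real a)(0 := real m))) \<Longrightarrow>
      (\<forall>a\<le>m. real (g a) = F2 ((\<lambda>_. real a)(0 := real m))) \<Longrightarrow>
      real (\<Sum>s<m - k + 1. \<Sum>d<k + 1. f (s + d + (1 - 1)) * g (s + (k - d)))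
        = H ((\<lambda>_. real k)(0 := real m))"
    using double_sum_polyfun[OF F(1,2), of 1] by blast
  have "real (count_Q t (Node l r) k) = H ((\<lambda>_. real k)(0 := real t))" if "k \<le> t" for t k
    unfolding count_Q_Node[OF that] using H[OF that, of "count_Q t l" "count_Q t r"] F(3,4) by simp
  with \<open>polyfun H\<close> show ?case by blast
qed

text \<open>The polynomial is in \<open>m = t / 2\<close>, and each node contributes one double sum
  for even totals and one for odd totals.\<close>

lemma count_P_even_polyfun:
  "\<exists>F. polyfun F \<and> (\<forall>m. \<forall>k\<le>m. real (count_P (2 * m) s k) = F ((\<lambda>_. real k)(0 := real m)))"
proof (induction s)
  case Leaf
  show ?case using polyfun_const[of 1] by auto
next
  case (Node l r)
  then obtain F1 F2 where F: "polyfun F1" "polyfun F2"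
    "\<And>m k. k \<le> m \<Longrightarrow> real (count_P (2 * m) l k) = F1 ((\<lambda>_. real k)(0 := real m))"
    "\<And>m k. k \<le> m \<Longrightarrow> real (count_P (2 * m) r k) = F2 ((\<lambda>_. real k)(0 := real m))"
    by metis
  obtain H where "polyfun H" and H: "\<And>m k f g. k \<le> m \<Longrightarrow>
      (\<forall>a\<le>m. real (f a) = F1 ((\<lambda>_. real a)(0 := real m))) \<Longrightarrow>
      (\<forall>a\<le>m. real (g a) = F2 ((\<lambda>_. real a)(0 := real m))) \<Longrightarrow>
      real (\<Sum>s<m - k + 1. \<Sum>d<k + 1. f (s + d + (1 - 1)) * g (s + (k - d)))
        = H ((\<lambda>_. real k)(0 := real m))"
    using double_sum_polyfun[OF F(1,2), of 1] by blast
  obtain K where "polyfun K" and K: "\<And>m k f g. k \<le> m \<Longrightarrow>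
      (\<forall>a\<le>m. real (f a) = F1 ((\<lambda>_. real a)(0 := real m))) \<Longrightarrow>
      (\<forall>a\<le>m. real (g a) = F2 ((\<lambda>_. real a)(0 := real m))) \<Longrightarrow>
      real (\<Sum>s<m - k + 0. \<Sum>d<k + 0. f (s + d + (1 - 0)) * g (s + (k - d)))
        = K ((\<lambda>_. real k)(0 := real m))"
    using double_sum_polyfun[OF F(1,2), of 0] by blast
  have "real (count_P (2 * m) (Node l r) k) = (\<lambda>x. H x + K x) ((\<lambda>_. real k)(0 := real m))" if "k \<le> m" for m k
    unfolding count_P_even_Node[OF that] of_nat_add
    using H[OF that, of "count_P (2 * m) l" "count_P (2 * m) r"] K[OF that, of "count_P (2 * m) l" "count_P (2 * m) r"] F(3,4)
    by simp
  with polyfun_add[OF \<open>polyfun H\<close> \<open>polyfun K\<close>] show ?case by blast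
qed

text \<open>Sums out the root label over its \<open>t + 1\<close> values; evaluating the result with
  every coordinate equal to \<open>t\<close> leaves a polynomial in one variable.\<close>

lemma sum_polyfun_poly:
  assumes "polyfun F" "\<And>t k. k \<le> t \<Longrightarrow> real (f t k) = F ((\<lambda>_. real k)(0 := real t))"
  shows "\<exists>p. \<forall>t. real (\<Sum>k\<le>t. f t k) = poly p (real t)"
proof -
  define G where "G x = F (\<lambda>j. (if j = 0 then (\<lambda>x. x 0) else (\<lambda>x. x 1)) x)" for x :: "nat \<Rightarrow> real"
  have "polyfun G" unfolding G_def
    by (rule polyfun_subst[OF assms(1)]) (auto intro: polyfun_var)
  moreover have "polyfun (\<lambda>x. x 0 + 1)" by (intro polyfun_add polyfun_var polyfun_const)
  ultimately obtain H where H: "polyfun H"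
    "\<And>x n. x 0 + 1 = real n \<Longrightarrow> (\<Sum>d<n. G (x(1 := real d))) = H x"
    using polyfun_sum[of G "\<lambda>x. x 0 + 1" 1] by blast
  obtain p where p: "\<And>y. H (\<lambda>i. poly [:0, 1:] y) = poly p y"
    using polyfun_univariate[OF H(1), of "\<lambda>_. [:0, 1:]"] by blast
  have "real (\<Sum>k\<le>t. f t k) = poly p (real t)" for t
  proof -
    have "real (\<Sum>k\<le>t. f t k) = (\<Sum>k<Suc t. G ((\<lambda>_::nat. real t)(1 := real k)))"
      unfolding lessThan_Suc_atMost of_nat_sum
    proof (rule sum.cong)
      fix k assume "k \<in> {..t}"
      have "(\<lambda>j::nat. (if j = 0 then (\<lambda>x. x 0) else (\<lambda>x. x 1)) ((\<lambda>_::nat. real t)(1 := real k))) = (\<lambda>_. real k)(0 := real t)"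
        by auto
      with assms(2) \<open>k \<in> {..t}\<close> show "real (f t k) = G ((\<lambda>_::nat. real t)(1 := real k))"
        by (simp add: G_def del: fun_upd_apply)
    qed simp
    also have "\<dots> = H (\<lambda>_. real t)" by (rule H(2)) simp
    also have "\<dots> = poly p (real t)" using p[of "real t"] by simp
    finally show ?thesis .
  qed
  then show ?thesis by blast
qed

text \<open>Replacing two of the three labels at a node by their differences from \<open>t\<close>
  preserves \<open>tri_Q t\<close>: it permutes the three triangle inequalities and the bound on the
  total. Reflecting the root label and the label of the left child at each step moves the change
  down the leftmost path to a leaf.\<close>

lemma count_Q_reflect:
  assumes "k \<le> t"
  shows "count_Q t s (t - k) = count_Q t s k"
  using assms
proof (induction s arbitrary: k)
  case (Node l r)
  show ?case
    unfolding count_shape.simps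
  proof (rule sum.reindex_bij_witness[where i = "\<lambda>(a, b). (t - a, b)" and j = "\<lambda>(a, b). (t - a, b)"], goal_cases)
    case (5 p)
    then show ?case using Node.IH(1)[of "fst p"] by (auto simp: case_prod_unfold)
  qed (use Node.prems in \<open>auto simp: tri_Q_triple\<close>)
qed simp

primrec internal_size :: "shape \<Rightarrow> nat" where
  "internal_size Leaf = 0"
| "internal_size (Node l r) = Suc (internal_size l + internal_size r)"

text \<open>For odd \<open>t\<close> the reflection \<open>a \<mapsto> t - a\<close> reverses parity, so that at each internal node the
  labellings with two odd lower labels are equinumerous with those with two even ones; the even ones
  are the doubled labellings counted by \<open>count_P\<close>.\<close>

lemma count_Q_odd:
  assumes t: "t = 2 * m + 1" and "k \<le> m"
  shows "count_Q t s (2 * k) = 2 ^ internal_size s * count_P t s k"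
  using assms(2)
proof (induction s arbitrary: k)
  case (Node l r)
  let ?f = "\<lambda>(a, b). count_Q t l a * count_Q t r b"
  let ?S = "{(a, b). a \<le> m \<and> b \<le> m \<and> tri_P t {#k, a, b#}}"
  let ?E = "{(a, b). a \<le> t \<and> b \<le> t \<and> tri_Q t {#2 * k, a, b#} \<and> even a}"
  let ?O = "{(a, b). a \<le> t \<and> b \<le> t \<and> tri_Q t {#2 * k, a, b#} \<and> odd a}"
  have E: "sum ?f ?E = (\<Sum>(a, b)\<in>?S. count_Q t l (2 * a) * count_Q t r (2 * b))"
    by (rule sum.reindex_bij_witness[where i = "\<lambda>(a, b). (2 * a, 2 * b)" and j = "\<lambda>(a, b). (a div 2, b div 2)"])
      (use t in \<open>auto simp: tri_Q_triple tri_P_triple elim!: evenE\<close>)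
  \<comment> \<open>With \<open>2 * k\<close> and the total even, \<open>a\<close> and
    \<open>b\<close> are both odd. As \<open>t\<close> is odd, their reflections are even and can be
    halved; the counts are unchanged by \<open>count_Q_reflect\<close>.\<close>
  have O: "sum ?f ?O = (\<Sum>(a, b)\<in>?S. count_Q t l (2 * a) * count_Q t r (2 * b))"
  proof (rule sum.reindex_bij_witness[where i = "\<lambda>(a, b). (t - 2 * a, t - 2 * b)"
        and j = "\<lambda>(a, b). ((t - a) div 2, (t - b) div 2)"], goal_cases)
    case (1 p)
    then show ?case using t by (auto simp: tri_Q_triple elim!: oddE)
  next
    case (2 p)
    then show ?case using t by (auto simp: tri_Q_triple tri_P_triple simp flip: diff_mult_distrib2 elim!: oddE)
  next
    case (3 p)
    then show ?case using t by auto
  next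
    case (4 p)
    then show ?case using t by (auto simp: tri_Q_triple tri_P_triple)
  next
    case (5 p)
    then show ?case
      using t count_Q_reflect[of "fst p" t l] count_Q_reflect[of "snd p" t r]
      by (auto simp: tri_Q_triple)
  qed
  have "{(a, b). a \<le> t \<and> b \<le> t \<and> tri_Q t {#2 * k, a, b#}} = ?E \<union> ?O" by auto
  then have "count_Q t (Node l r) (2 * k) = sum ?f (?E \<union> ?O)" by simp
  also have "\<dots> = sum ?f ?E + sum ?f ?O"
    by (rule sum.union_disjoint) (auto intro: finite_pairs)
  also have "\<dots> = 2 * (\<Sum>(a, b)\<in>?S. count_Q t l (2 * a) * count_Q t r (2 * b))"
    unfolding E O by simp
  also have "(\<Sum>(a, b)\<in>?S. count_Q t l (2 * a) * count_Q t r (2 * b))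
      = (\<Sum>(a, b)\<in>?S. 2 ^ (internal_size l + internal_size r) * (count_P t l a * count_P t r b))"
    by (rule sum.cong) (auto simp: Node.IH power_add)
  also have "\<dots> = 2 ^ (internal_size l + internal_size r) * count_P t (Node l r) k"
    using t by (simp add: sum_distrib_left case_prod_unfold)
  finally show ?case by simp
qed simp

text \<open>The factor beyond those of the internal nodes comes from the root label, whose odd
  values are reflected to even ones.\<close>

lemma total_Q_odd:
  assumes t: "t = 2 * m + 1"
  shows "(\<Sum>k\<le>t. count_Q t s k) = 2 ^ Suc (internal_size s) * (\<Sum>k\<le>t div 2. count_P t s k)"
proof -
  have "sum (count_Q t s) {k. k \<le> t \<and> even k} = (\<Sum>k\<le>m. count_Q t s (2 * k))"
    by (rule sum.reindex_bij_witness[where i = "\<lambda>k. 2 * k" and j = "\<lambda>k. k div 2"]) (use t in auto)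
  moreover have "sum (count_Q t s) {k. k \<le> t \<and> odd k} = (\<Sum>k\<le>m. count_Q t s (2 * k))"
    by (rule sum.reindex_bij_witness[where i = "\<lambda>k. t - 2 * k" and j = "\<lambda>k. (t - k) div 2"])
      (use t in \<open>auto simp: count_Q_reflect\<close>)
  moreover have "{..t} = {k. k \<le> t \<and> even k} \<union> {k. k \<le> t \<and> odd k}" by auto
  then have "(\<Sum>k\<le>t. count_Q t s k) = sum (count_Q t s) {k. k \<le> t \<and> even k} + sum (count_Q t s) {k. k \<le> t \<and> odd k}"
    by (simp only:) (rule sum.union_disjoint, auto)
  moreover have "(\<Sum>k\<le>m. count_Q t s (2 * k)) = 2 ^ internal_size s * (\<Sum>k\<le>m. count_P t s k)"
    by (simp add: count_Q_odd[OF t] sum_distrib_left)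
  moreover have "t div 2 = m" using t by simp
  ultimately show ?thesis by simp
qed

lemma count_zero: "count_shape (tri_P 0) 0 s 0 = 1" "count_Q 0 s 0 = 1"
proof -
  have "{(a, b). a = 0 \<and> b = 0 \<and> tri_P 0 {#0, a, b#}} = {(0, 0)}"
    "{(a, b). a = 0 \<and> b = 0 \<and> tri_Q 0 {#0, a, b#}} = {(0, 0)}"
    by (auto simp: tri_P_triple tri_Q_triple)
  then show "count_shape (tri_P 0) 0 s 0 = 1" "count_Q 0 s 0 = 1" by (induction s) simp_all
qed

subsection \<open>Decomposing a tree along its edges\<close>

definition delete_edge :: "('v, 'e) mgraph \<Rightarrow> 'e \<Rightarrow> ('v, 'e) mgraph" where
  "delete_edge G a = G\<lparr>edges := edges G - {a}\<rparr>"

text \<open>The node set of the component of \<open>x\<close> after deletion of \<open>a\<close>.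
  When \<open>a\<close> ends at \<open>x\<close>, this is the part of the tree that hangs beyond
  \<open>a\<close>.\<close>

definition side :: "('v, 'e) mgraph \<Rightarrow> 'e \<Rightarrow> 'v \<Rightarrow> 'v set" where
  "side G a x = {p. (x, p) \<in> (adjacency (delete_edge G a))\<^sup>*}"

lemma adjacency_delete_edge:
  "(u, v) \<in> adjacency (delete_edge G a) \<longleftrightarrow> (\<exists>e\<in>edges G. e \<noteq> a \<and> ends G e = {#u, v#})"
  by (auto simp: adjacency_def delete_edge_def)

lemma sym_adjacency: "sym (adjacency G)"
  by (auto simp: adjacency_def sym_def add_mset_commute)

lemma side_self: "x \<in> side G a x"
  by (simp add: side_def)

text \<open>Cycles are required to have distinct nodes, so walks must be shortened: on reaching a
  node already visited, the path is cut back to it.\<close>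

lemma rtrancl_distinct_path:
  assumes "(u, v) \<in> R\<^sup>*"
  shows "\<exists>vs. vs \<noteq> [] \<and> distinct vs \<and> hd vs = u \<and> last vs = v \<and>
    (\<forall>i. Suc i < length vs \<longrightarrow> (vs ! i, vs ! Suc i) \<in> R)"
  using assms
proof (induction rule: rtrancl_induct)
  case base
  show ?case by (rule exI[of _ "[u]"]) simp
next
  case (step y z)
  then obtain vs where vs: "vs \<noteq> []" "distinct vs" "hd vs = u" "last vs = y"
    "\<forall>i. Suc i < length vs \<longrightarrow> (vs ! i, vs ! Suc i) \<in> R"
    by blast
  show ?case
  proof (cases "z \<in> set vs")
    case True
    then obtain j where j: "j < length vs" "vs ! j = z" by (auto simp: in_set_conv_nth)
    show ?thesis
      using vs j by (intro exI[of _ "take (Suc j) vs"]) (auto simp: last_conv_nth hd_take)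
  next
    case False
    have "((vs @ [z]) ! i, (vs @ [z]) ! Suc i) \<in> R" if "i < length vs" for i
    proof (cases "Suc i < length vs")
      case True
      with vs(5) show ?thesis by (simp add: nth_append)
    next
      case False
      with that have "i = length vs - 1" by simp
      with vs(1,4) step.hyps(2) show ?thesis by (simp add: nth_append last_conv_nth)
    qed
    with vs False show ?thesis by (intro exI[of _ "vs @ [z]"]) auto
  qed
qed

lemma size_2_doubleton_mset:
  assumes "size m = 2"
  shows "\<exists>b c. m = {#b, c#}"
proof -
  obtain b m' where m': "m = add_mset b m'"
    using size_eq_Suc_imp_eq_union[of m 1] assms by auto
  with assms have "size m' = 1" by simp
  with m' show ?thesis using size_1_singleton_mset by blast
qed

lemma edge_ends:
  assumes "finite_mgraph G" "e \<in> edges G" "x \<in># ends G e"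
  obtains y where "ends G e = {#x, y#}" "y \<in> nodes G"
proof -
  from assms(3) obtain m where m: "ends G e = add_mset x m" by (metis multi_member_split)
  with assms have "size m = 1" by (auto simp: finite_mgraph_def)
  then obtain y where "m = {#y#}" using size_1_singleton_mset by blast
  with m assms that show ?thesis by (auto simp: finite_mgraph_def)
qed

lemma edge_ends_ex:
  assumes "finite_mgraph G" "e \<in> edges G"
  obtains x y where "ends G e = {#x, y#}" "x \<in> nodes G" "y \<in> nodes G"
proof -
  have "ends G e \<noteq> {#}" using assms by (auto simp: finite_mgraph_def)
  then obtain x where x: "x \<in># ends G e" by blast
  then obtain y where "ends G e = {#x, y#}" "y \<in> nodes G" using edge_ends[OF assms] by blast
  moreover have "x \<in> nodes G" using x assms by (auto simp: finite_mgraph_def)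
  ultimately show ?thesis using that by blast
qed

text \<open>A path from \<open>u\<close> to \<open>v\<close> avoiding \<open>a\<close> would close
  up with \<open>a\<close> to a cycle. The case \<open>u = v\<close> is included and excludes
  loops.\<close>

lemma acyclic_bridge:
  assumes G: "finite_mgraph G" and nc: "\<nexists>vs es. cycle_in G vs es"
    and a: "a \<in> edges G" "ends G a = {#u, v#}"
  shows "v \<notin> side G a u"
proof
  assume "v \<in> side G a u"
  then obtain vs where vs: "vs \<noteq> []" "distinct vs" "hd vs = u" "last vs = v"
    "\<forall>i. Suc i < length vs \<longrightarrow> (vs ! i, vs ! Suc i) \<in> adjacency (delete_edge G a)"
    using rtrancl_distinct_path[of u v] unfolding side_def by blast
  define n where "n = length vs"
  have n: "n > 0" using vs(1) by (simp add: n_def)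
  obtain f where f: "\<And>i. Suc i < n \<Longrightarrow> f i \<in> edges G \<and> f i \<noteq> a \<and> ends G (f i) = {#vs ! i, vs ! Suc i#}"
    using vs(5) unfolding adjacency_delete_edge n_def by metis
  \<comment> \<open>The edges of the path, followed by \<open>a\<close> as closing edge.\<close>
  define g where "g i = (if Suc i < n then f i else a)" for i
  have g: "g i \<in> edges G \<and> ends G (g i) = {#vs ! i, vs ! (Suc i mod n)#}" if "i < n" for i
  proof (cases "Suc i < n")
    case True
    with f[OF True] show ?thesis by (simp add: g_def)
  next
    case False
    with that have "Suc i = n" by simp
    then have "vs ! i = v" "vs ! 0 = u"
      using vs by (auto simp: n_def last_conv_nth hd_conv_nth dest: sym)
    with \<open>Suc i = n\<close> a show ?thesis by (simp add: g_def add_mset_commute)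
  qed
  \<comment> \<open>The node \<open>vs ! i\<close> is an end of \<open>f i\<close>, whereas both
    ends of \<open>f j\<close> occur later on the path.\<close>
  have neq: "f i \<noteq> f j" if "i < j" "Suc j < n" for i j
  proof
    assume eq: "f i = f j"
    have "vs ! i \<in># ends G (f i)" using f[of i] that by simp
    with eq have "vs ! i = vs ! j \<or> vs ! i = vs ! Suc j" using f[of j] that by simp
    with that vs(2) show False by (auto simp: n_def nth_eq_iff_index_eq)
  qed
  have "inj_on g {..<n}"
  proof (rule linorder_inj_onI)
    fix i j assume "i < j" "i \<in> {..<n}" "j \<in> {..<n}"
    then show "g i \<noteq> g j"
      using neq[of i j] f[of i] by (auto simp: g_def)
  qed auto
  then have "distinct (map g [0..<n])"
    by (simp add: distinct_map lessThan_atLeast0)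
  moreover have "set vs \<subseteq> nodes G"
  proof
    fix p assume "p \<in> set vs"
    then obtain i where i: "i < n" "p = vs ! i" by (auto simp: in_set_conv_nth n_def)
    then have "p \<in># ends G (g i)" using g by simp
    with g[OF i(1)] G show "p \<in> nodes G" by (auto simp: finite_mgraph_def)
  qed
  ultimately have "cycle_in G vs (map g [0..<n])"
    using vs g by (auto simp: cycle_in_def n_def)
  with nc show False by blast
qed

lemma count_incident_edges:
  assumes "finite_mgraph G"
  shows "count (incident_edges G v) e = (if e \<in> edges G then count (ends G e) v else 0)"
proof -
  have fin: "finite (edges G)" using assms by (simp add: finite_mgraph_def)
  have "count (incident_edges G v) e = (\<Sum>f\<in>edges G. if f = e then count (ends G f) v else 0)"
    unfolding incident_edges_def count_sum by (rule sum.cong) auto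
  then show ?thesis using fin by simp
qed

lemma mem_incident_edges:
  assumes "finite_mgraph G"
  shows "e \<in># incident_edges G v \<longleftrightarrow> e \<in> edges G \<and> v \<in># ends G e"
proof -
  have "e \<in># incident_edges G v \<longleftrightarrow> count (incident_edges G v) e > 0" by simp
  then show ?thesis unfolding count_incident_edges[OF assms] by auto
qed

text \<open>Beyond a bridge \<open>b\<close> at \<open>x\<close> one never meets \<open>x\<close> again, so that the other edges at \<open>x\<close>
  may be deleted as well.\<close>

lemma side_eq_avoiding:
  assumes "b \<in> edges G" "ends G b = {#x, y#}" "x \<notin> side G b y"
  shows "side G b y = {p. (y, p) \<in> {(u, v) \<in> adjacency G. u \<noteq> x \<and> v \<noteq> x}\<^sup>*}" (is "_ = {p. (y, p) \<in> ?N\<^sup>*}")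
proof (intro equalityI subsetI)
  fix p assume "p \<in> side G b y"
  then have "(y, p) \<in> (adjacency (delete_edge G b))\<^sup>*" by (simp add: side_def)
  \<comment> \<open>Membership in the side is carried along because it shows that every node reached
    differs from \<open>x\<close>.\<close>
  then have "(y, p) \<in> ?N\<^sup>* \<and> p \<in> side G b y"
  proof (induction rule: rtrancl_induct)
    case base
    show ?case by (simp add: side_self)
  next
    case (step p q)
    then have "q \<in> side G b y" by (auto simp: side_def intro: rtrancl_into_rtrancl)
    moreover have "(p, q) \<in> adjacency G"
      using step.hyps(2) by (auto simp: adjacency_delete_edge) (auto simp: adjacency_def)
    then have "(p, q) \<in> ?N"
      using step.IH assms(3) \<open>q \<in> side G b y\<close> by auto
    ultimately show ?case using step.IH by (auto intro: rtrancl_into_rtrancl)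
  qed
  then show "p \<in> {p. (y, p) \<in> ?N\<^sup>*}" by simp
next
  have "?N \<subseteq> adjacency (delete_edge G b)"
  proof
    fix p assume "p \<in> ?N"
    then obtain u v e where e: "p = (u, v)" "e \<in> edges G" "ends G e = {#u, v#}" "u \<noteq> x" "v \<noteq> x"
      by (auto simp: adjacency_def)
    then have "x \<notin># ends G e" by simp
    with assms(2) have "e \<noteq> b" by auto
    with e show "p \<in> adjacency (delete_edge G b)" by (auto simp: adjacency_delete_edge)
  qed
  then show "p \<in> side G b y" if "p \<in> {p. (y, p) \<in> ?N\<^sup>*}" for p
    using that rtrancl_mono by (auto simp: side_def)
qed

section \<open>Subtrees hanging at the edges of the tree\<close>

locale tree13_graph =
  fixes G :: "('v, 'e) mgraph"
  assumes tree13: "tree13 G"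
begin

lemma fin: "finite_mgraph G" and degree: "v \<in> nodes G \<Longrightarrow> node_degree G v = 1 \<or> node_degree G v = 3"
  using tree13 by (auto simp: tree13_def graph13_def)

lemma bridge:
  assumes "a \<in> edges G" "ends G a = {#u, v#}"
  shows "v \<notin> side G a u"
  using acyclic_bridge[OF fin _ assms] tree13 by (auto simp: tree13_def tree_mgraph_def)

lemma side_subset_nodes:
  assumes "x \<in> nodes G"
  shows "side G a x \<subseteq> nodes G"
proof
  fix p assume "p \<in> side G a x"
  then have "(x, p) \<in> (adjacency (delete_edge G a))\<^sup>*" by (simp add: side_def)
  then show "p \<in> nodes G"
    by (induction rule: rtrancl_induct)
      (use assms fin in \<open>auto simp: adjacency_delete_edge finite_mgraph_def\<close>)
qed

lemma finite_side: "x \<in> nodes G \<Longrightarrow> finite (side G a x)"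
  by (rule finite_subset[OF side_subset_nodes]) (use fin in \<open>auto simp: finite_mgraph_def\<close>)

lemma leaf_incident:
  assumes "a \<in> edges G" "x \<in># ends G a" "node_degree G x = 1"
  shows "incident_edges G x = {#a#}"
proof -
  have "a \<in># incident_edges G x" using assms by (simp add: mem_incident_edges[OF fin])
  then show ?thesis using assms(3) unfolding node_degree_def
    by (auto simp: size_1_singleton_mset dest!: multi_member_split)
qed

lemma side_leaf:
  assumes "a \<in> edges G" "x \<in># ends G a" "node_degree G x = 1"
  shows "side G a x = {x}"
proof -
  have "p = x" if "(x, p) \<in> (adjacency (delete_edge G a))\<^sup>*" for p
    using that
  proof (induction rule: rtrancl_induct)
    case (step p q)
    then obtain e where e: "e \<in> edges G" "e \<noteq> a" "ends G e = {#x, q#}"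
      by (auto simp: adjacency_delete_edge)
    then have "e \<in># incident_edges G x" by (simp add: mem_incident_edges[OF fin])
    with leaf_incident[OF assms] e show ?case by simp
  qed simp
  then show ?thesis by (auto simp: side_def)
qed

text \<open>The recursive step: beyond \<open>a\<close>, an internal node \<open>x\<close> splits
  the tree into two smaller parts, joined to \<open>x\<close> by \<open>b\<close> and
  \<open>c\<close>. Disjointness and the absence of edges between the parts are what make labellings
  of the two parts independent.\<close>

lemma side_internal:
  assumes a: "a \<in> edges G" "ends G a = {#v, x#}" and deg: "node_degree G x = 3"
  obtains b c y z where "b \<in> edges G" "c \<in> edges G" "incident_edges G x = {#a, b, c#}"
    "ends G b = {#x, y#}" "ends G c = {#x, z#}" "y \<in> nodes G" "z \<in> nodes G"
    "side G a x = insert x (side G b y \<union> side G c z)"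
    "x \<notin> side G b y" "x \<notin> side G c z" "side G b y \<inter> side G c z = {}"
    "\<forall>p\<in>side G b y. \<forall>q\<in>side G c z. (p, q) \<notin> adjacency G"
proof -
  have "a \<in># incident_edges G x" using a by (simp add: mem_incident_edges[OF fin])
  then obtain m where m: "incident_edges G x = add_mset a m" by (metis multi_member_split)
  with deg have "size m = 2" by (simp add: node_degree_def)
  then obtain b c where "m = {#b, c#}" using size_2_doubleton_mset by blast
  with m have inc: "incident_edges G x = {#a, b, c#}" by simp
  then have b: "b \<in> edges G" "x \<in># ends G b" and c: "c \<in> edges G" "x \<in># ends G c"
    using mem_incident_edges[OF fin, of _ x] by auto
  obtain y where y: "ends G b = {#x, y#}" "y \<in> nodes G" using edge_ends[OF fin b] .
  obtain z where z: "ends G c = {#x, z#}" "z \<in> nodes G" using edge_ends[OF fin c] .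
  \<comment> \<open>Only a loop could be listed twice at \<open>x\<close>, and \<open>bridge\<close>
    excludes loops; hence \<open>a\<close>, \<open>b\<close>, \<open>c\<close> are distinct.\<close>
  have simple: "count (incident_edges G x) e \<le> 1" for e
  proof (cases "e \<in> edges G \<and> x \<in># ends G e")
    case True
    then obtain p where p: "ends G e = {#x, p#}" using edge_ends[OF fin] by metis
    then have "p \<noteq> x" using bridge[of e x p] True by (auto simp: side_self)
    with p show ?thesis by (simp add: count_incident_edges[OF fin])
  next
    case False
    then show ?thesis by (auto simp: count_incident_edges[OF fin] not_in_iff)
  qed
  have neq: "a \<noteq> b" "a \<noteq> c" "b \<noteq> c"
    using simple[of a] simple[of b] unfolding inc by (auto split: if_splits)
  have xy: "x \<notin> side G b y" using bridge[of b y x] b y by (simp add: add_mset_commute)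
  have xz: "x \<notin> side G c z" using bridge[of c z x] c z by (simp add: add_mset_commute)
  \<comment> \<open>A single relation, adjacency away from \<open>x\<close>, describes both sides;
    its symmetry allows paths in the two to be joined.\<close>
  define N where "N = {(u, v) \<in> adjacency G. u \<noteq> x \<and> v \<noteq> x}"
  have sb: "side G b y = {p. (y, p) \<in> N\<^sup>*}"
    unfolding N_def by (rule side_eq_avoiding[OF b(1) y(1) xy])
  have sc: "side G c z = {p. (z, p) \<in> N\<^sup>*}"
    unfolding N_def by (rule side_eq_avoiding[OF c(1) z(1) xz])
  have "sym N" using sym_adjacency[of G] unfolding N_def sym_def by blast
  then have symN: "sym (N\<^sup>*)" by (rule sym_rtrancl)
  have sub: "N\<^sup>* \<subseteq> (adjacency (delete_edge G e))\<^sup>*" if "x \<in># ends G e" for e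
  proof (rule rtrancl_mono, rule subsetI)
    fix p assume "p \<in> N"
    then obtain u v f where f: "p = (u, v)" "f \<in> edges G" "ends G f = {#u, v#}" "u \<noteq> x" "v \<noteq> x"
      by (auto simp: N_def adjacency_def)
    then have "x \<notin># ends G f" by simp
    with that have "f \<noteq> e" by auto
    with f show "p \<in> adjacency (delete_edge G e)" by (auto simp: adjacency_delete_edge)
  qed
  \<comment> \<open>A common node would give a path from \<open>y\<close> to \<open>z\<close> away
    from \<open>x\<close>; continued through \<open>c\<close> it reaches \<open>x\<close> without
    using \<open>b\<close>, which is a bridge.\<close>
  have disj: "side G b y \<inter> side G c z = {}"
  proof (rule ccontr)
    assume "side G b y \<inter> side G c z \<noteq> {}"
    then obtain p where "(y, p) \<in> N\<^sup>*" "(z, p) \<in> N\<^sup>*" unfolding sb sc by blast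
    then have "(y, z) \<in> N\<^sup>*" using symN by (meson rtrancl_trans symD)
    then have "(y, z) \<in> (adjacency (delete_edge G b))\<^sup>*" using sub[of b] b by blast
    moreover have "(z, x) \<in> adjacency (delete_edge G b)"
      using c z neq by (auto simp: adjacency_delete_edge add_mset_commute)
    ultimately show False using xy by (auto simp: side_def intro: rtrancl_into_rtrancl)
  qed
  have nonadj: "(p, q) \<notin> adjacency G" if "p \<in> side G b y" "q \<in> side G c z" for p q
  proof
    assume "(p, q) \<in> adjacency G"
    then have "(p, q) \<in> N" using that xy xz by (auto simp: N_def)
    then have "q \<in> side G b y" using that(1) unfolding sb by auto
    with that(2) disj show False by blast
  qed
  have "side G a x = insert x (side G b y \<union> side G c z)"
  proof (intro equalityI subsetI)
    fix p assume "p \<in> side G a x"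
    then have "(x, p) \<in> (adjacency (delete_edge G a))\<^sup>*" by (simp add: side_def)
    then show "p \<in> insert x (side G b y \<union> side G c z)"
    proof (induction rule: rtrancl_induct)
      case (step p q)
      then obtain e where e: "e \<in> edges G" "e \<noteq> a" "ends G e = {#p, q#}"
        by (auto simp: adjacency_delete_edge)
      show ?case
      proof (cases "p = x")
        case True
        with e have "e \<in># incident_edges G x" by (simp add: mem_incident_edges[OF fin])
        with e(2) inc have "e = b \<or> e = c" by simp
        with e(3) True y z have "q = y \<or> q = z" by auto
        then show ?thesis by (auto simp: side_self)
      next
        case False
        show ?thesis
        proof (cases "q = x")
          case False
          with e \<open>p \<noteq> x\<close> have "(p, q) \<in> N" by (auto simp: N_def adjacency_def)
          with step.IH \<open>p \<noteq> x\<close> show ?thesis unfolding sb sc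
            by (auto intro: rtrancl_into_rtrancl)
        qed simp
      qed
    qed simp
  next
    fix p assume "p \<in> insert x (side G b y \<union> side G c z)"
    then consider "p = x" | "(y, p) \<in> N\<^sup>*" | "(z, p) \<in> N\<^sup>*" unfolding sb sc by blast
    then show "p \<in> side G a x"
    proof cases
      case 2
      then have "(y, p) \<in> (adjacency (delete_edge G a))\<^sup>*" using sub[of a] a by auto
      moreover have "(x, y) \<in> adjacency (delete_edge G a)"
        using b y neq by (auto simp: adjacency_delete_edge)
      ultimately show ?thesis by (simp add: side_def)
    next
      case 3
      then have "(z, p) \<in> (adjacency (delete_edge G a))\<^sup>*" using sub[of a] a by auto
      moreover have "(x, z) \<in> adjacency (delete_edge G a)"
        using c z neq by (auto simp: adjacency_delete_edge)
      ultimately show ?thesis by (simp add: side_def)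
    qed (simp add: side_self)
  qed
  from that[OF b(1) c(1) inc y(1) z(1) y(2) z(2) this xy xz disj] nonadj show ?thesis by blast
qed

text \<open>Provides the leaf used as root: at an internal node one passes to one of the two smaller
  sides, so the descent ends at a leaf.\<close>

lemma leaf_in_side:
  assumes "a \<in> edges G" "ends G a = {#v, x#}"
  shows "\<exists>u\<in>side G a x. u \<in> nodes G \<and> node_degree G u = 1"
  using assms
proof (induction "card (side G a x)" arbitrary: a v x rule: less_induct)
  case less
  have x: "x \<in> nodes G" using less.prems fin by (auto simp: finite_mgraph_def)
  show ?case
  proof (cases "node_degree G x = 1")
    case True
    with x side_self[of x G a] show ?thesis by auto
  next
    case False
    with degree x have deg: "node_degree G x = 3" by blast
    obtain b c y z where b: "b \<in> edges G" and "c \<in> edges G" "incident_edges G x = {#a, b, c#}"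
      and y: "ends G b = {#x, y#}" and "ends G c = {#x, z#}" "y \<in> nodes G" "z \<in> nodes G"
      and s: "side G a x = insert x (side G b y \<union> side G c z)" and xn: "x \<notin> side G b y"
      and "x \<notin> side G c z" "side G b y \<inter> side G c z = {}"
        "\<forall>p\<in>side G b y. \<forall>q\<in>side G c z. (p, q) \<notin> adjacency G"
      using side_internal[OF less.prems deg] .
    have "side G b y \<subset> side G a x" using s xn by auto
    then have "card (side G b y) < card (side G a x)"
      by (rule psubset_card_mono[OF finite_side[OF x]])
    from less.hyps[OF this b y] s show ?thesis by blast
  qed
qed

end

text \<open>\<open>branch e A \<tau> s\<close>: the edges \<open>A\<close> form a rooted binary tree of shape \<open>s\<close> with root edge \<open>e\<close>, and \<open>\<tau>\<close>
  collects the triples of edges meeting at its internal nodes.\<close>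

inductive branch :: "'e \<Rightarrow> 'e set \<Rightarrow> 'e multiset set \<Rightarrow> shape \<Rightarrow> bool" where
  branch_Leaf: "branch e {e} {} Leaf"
| branch_Node: "branch a A \<tau> l \<Longrightarrow> branch b B \<sigma> r \<Longrightarrow> A \<inter> B = {} \<Longrightarrow> e \<notin> A \<union> B \<Longrightarrow>
    branch e (insert e (A \<union> B)) (insert {#e, a, b#} (\<tau> \<union> \<sigma>)) (Node l r)"

context tree13_graph
begin

text \<open>The branch consists of all edges meeting the side, hence contains \<open>a\<close>
  itself through its end \<open>x\<close>. The induction is on the number of nodes beyond
  \<open>a\<close>.\<close>

lemma branch_side:
  assumes "a \<in> edges G" "ends G a = {#v, x#}"
  shows "\<exists>s. branch a {e \<in> edges G. \<exists>p\<in>side G a x. p \<in># ends G e}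
    (incident_edges G ` (internal_nodes G \<inter> side G a x)) s"
  using assms
proof (induction "card (side G a x)" arbitrary: a v x rule: less_induct)
  case less
  let ?A = "\<lambda>a x. {e \<in> edges G. \<exists>p\<in>side G a x. p \<in># ends G e}"
  let ?T = "\<lambda>a x. incident_edges G ` (internal_nodes G \<inter> side G a x)"
  have x: "x \<in> nodes G" "x \<in># ends G a" using less.prems fin by (auto simp: finite_mgraph_def)
  show ?case
  proof (cases "node_degree G x = 1")
    case True
    have "?A a x = {e \<in> edges G. e \<in># incident_edges G x}"
      using side_leaf[OF less.prems(1) x(2) True] by (auto simp: mem_incident_edges[OF fin])
    also have "\<dots> = {a}"
      using leaf_incident[OF less.prems(1) x(2) True] less.prems by auto
    finally have "?A a x = {a}" .
    moreover have "?T a x = {}"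
      using side_leaf[OF less.prems(1) x(2) True] True by (auto simp: internal_nodes_def)
    ultimately show ?thesis using branch_Leaf by metis
  next
    case False
    with degree x have deg: "node_degree G x = 3" by blast
    obtain b c y z where bc: "b \<in> edges G" "c \<in> edges G" and inc: "incident_edges G x = {#a, b, c#}"
      and yz: "ends G b = {#x, y#}" "ends G c = {#x, z#}" and "y \<in> nodes G" "z \<in> nodes G"
      and s: "side G a x = insert x (side G b y \<union> side G c z)"
      and xn: "x \<notin> side G b y" "x \<notin> side G c z" and disj: "side G b y \<inter> side G c z = {}"
      and nonadj: "\<forall>p\<in>side G b y. \<forall>q\<in>side G c z. (p, q) \<notin> adjacency G"
      using side_internal[OF less.prems deg] .
    note b = bc(1) yz(1) and c = bc(2) yz(2)
    have "side G b y \<subset> side G a x" "side G c z \<subset> side G a x"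
      using s xn by auto
    note smaller = this[THEN psubset_card_mono[OF finite_side[OF x(1)]]]
    obtain l where l: "branch b (?A b y) (?T b y) l"
      using less.hyps[OF smaller(1) b] by (rule exE)
    obtain r where r: "branch c (?A c z) (?T c z) r"
      using less.hyps[OF smaller(2) c] by (rule exE)
    \<comment> \<open>An edge meeting both sides would make a node of one adjacent to a node of the
      other.\<close>
    have disjA: "?A b y \<inter> ?A c z = {}"
    proof (rule ccontr)
      assume "?A b y \<inter> ?A c z \<noteq> {}"
      then obtain e p q where e: "e \<in> edges G" "p \<in># ends G e" "q \<in># ends G e"
        and pq: "p \<in> side G b y" "q \<in> side G c z" by blast
      from edge_ends[OF fin e(1,2)] obtain q' where q': "ends G e = {#p, q'#}" by blast
      with e pq disj have "q' = q" by auto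
      with q' e(1) have "(p, q) \<in> adjacency G" by (auto simp: adjacency_def)
      with nonadj pq show False by blast
    qed
    have "v \<notin> side G a x"
      using bridge[of a x v] less.prems by (simp add: add_mset_commute)
    then have aA: "a \<notin> ?A b y \<union> ?A c z"
      using less.prems(2) xn s by auto
    have "branch a (insert a (?A b y \<union> ?A c z)) (insert {#a, b, c#} (?T b y \<union> ?T c z)) (Node l r)"
      by (rule branch_Node[OF l r disjA aA])
    moreover have "insert a (?A b y \<union> ?A c z) = ?A a x"
    proof -
      have "e \<in> insert a (?A b y \<union> ?A c z)" if "e \<in> edges G" "x \<in># ends G e" for e
      proof -
        have "e \<in># incident_edges G x" using that by (simp add: mem_incident_edges[OF fin])
        then show ?thesis using inc b c side_self[of y G b] side_self[of z G c] by auto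
      qed
      then show ?thesis using s less.prems by auto
    qed
    moreover have "x \<in> internal_nodes G" using x deg by (simp add: internal_nodes_def)
    then have "insert {#a, b, c#} (?T b y \<union> ?T c z) = ?T a x"
      unfolding s by (simp add: Int_Un_distrib image_Un inc)
    ultimately show ?thesis by auto
  qed
qed

text \<open>The root edge \<open>a\<close> is the only edge at a leaf \<open>v0\<close>. By
  connectedness every other node lies beyond \<open>a\<close>, so the branch at \<open>a\<close>
  covers all edges and all internal nodes.\<close>

lemma branch_tree: "\<exists>e s. branch e (edges G) (incident_edges G ` internal_nodes G) s"
proof -
  obtain w where w: "w \<in> nodes G" using tree13 by (auto simp: tree13_def tree_mgraph_def connected_mgraph_def)
  then have "incident_edges G w \<noteq> {#}" using degree[OF w] by (auto simp: node_degree_def)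
  then obtain e where "e \<in> edges G" by (metis mem_incident_edges[OF fin] multiset_nonemptyE)
  then obtain u v where "ends G e = {#u, v#}" using edge_ends_ex[OF fin] by metis
  from leaf_in_side[OF \<open>e \<in> edges G\<close> this] obtain v0 where v0: "v0 \<in> nodes G" "node_degree G v0 = 1"
    by blast
  then have "incident_edges G v0 \<noteq> {#}" by (auto simp: node_degree_def)
  then obtain a where a: "a \<in> edges G" "v0 \<in># ends G a"
    by (metis mem_incident_edges[OF fin] multiset_nonemptyE)
  obtain x where x: "ends G a = {#v0, x#}" "x \<in> nodes G" using edge_ends[OF fin a] .
  have only: "e = a" if "e \<in> edges G" "v0 \<in># ends G e" for e
  proof -
    have "e \<in># incident_edges G v0" using that by (simp add: mem_incident_edges[OF fin])
    with leaf_incident[OF a v0(2)] show ?thesis by simp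
  qed
  have side: "p \<in> insert v0 (side G a x)" if "p \<in> nodes G" for p
  proof -
    have "(x, p) \<in> (adjacency G)\<^sup>*"
      using tree13 x that by (auto simp: tree13_def tree_mgraph_def connected_mgraph_def)
    then show ?thesis
    proof (induction rule: rtrancl_induct)
      case base
      show ?case by (simp add: side_self)
    next
      case (step p q)
      then obtain e where e: "e \<in> edges G" "ends G e = {#p, q#}" by (auto simp: adjacency_def)
      show ?case
      proof (cases "e = a")
        case True
        with e x have "q \<in># {#v0, x#}" by auto
        then show ?thesis by (auto simp: side_self)
      next
        case False
        then have "p \<noteq> v0" using only e by auto
        moreover have "(p, q) \<in> adjacency (delete_edge G a)"
          using False e by (auto simp: adjacency_delete_edge)
        ultimately show ?thesis
          using step.IH by (auto simp: side_def intro: rtrancl_into_rtrancl)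
      qed
    qed
  qed
  have "{e \<in> edges G. \<exists>p\<in>side G a x. p \<in># ends G e} = edges G"
  proof (intro equalityI subsetI)
    fix e assume e: "e \<in> edges G"
    show "e \<in> {e \<in> edges G. \<exists>p\<in>side G a x. p \<in># ends G e}"
    proof (cases "e = a")
      case True
      then show ?thesis using a x side_self[of x G a] by auto
    next
      case False
      obtain p q where "ends G e = {#p, q#}" "p \<in> nodes G" using edge_ends_ex[OF fin e] by metis
      moreover then have "p \<noteq> v0" using False only e by auto
      ultimately show ?thesis using side[of p] e by auto
    qed
  qed simp
  moreover have "internal_nodes G \<inter> side G a x = internal_nodes G"
    using side v0(2) unfolding internal_nodes_def by fastforce
  ultimately show ?thesis using branch_side[OF a(1) x(1)] by auto
qed

end

subsection \<open>Lattice points as labellings\<close>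

lemma branch_facts:
  assumes "branch e A \<tau> s"
  shows "e \<in> A \<and> finite A \<and> (\<forall>m\<in>\<tau>. set_mset m \<subseteq> A)"
  using assms by induction auto

text \<open>The condition at a node depends only on the multiset of its edges, so a set of such
  multisets can stand for the nodes. Keeping \<open>R\<close> and \<open>M\<close> as parameters
  treats both polytopes at once.\<close>

definition labellings :: "(nat multiset \<Rightarrow> bool) \<Rightarrow> nat \<Rightarrow> 'e set \<Rightarrow> 'e multiset set \<Rightarrow> ('e \<Rightarrow> nat) set" where
  "labellings R M A \<tau> = {w \<in> A \<rightarrow>\<^sub>E {..M}. \<forall>m\<in>\<tau>. R (image_mset w m)}"

lemma labellings_restrict:
  assumes "A' \<subseteq> A" "\<tau>' \<subseteq> \<tau>" "\<forall>m\<in>\<tau>'. set_mset m \<subseteq> A'" "w \<in> labellings R M A \<tau>"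
  shows "restrict w A' \<in> labellings R M A' \<tau>'"
proof -
  have "image_mset (restrict w A') m = image_mset w m" if "m \<in> \<tau>'" for m
    using assms(3) that by (intro image_mset_cong) auto
  with assms show ?thesis by (auto simp: labellings_def PiE_iff)
qed

lemma finite_labellings: "finite A \<Longrightarrow> finite (labellings R M A \<tau>)"
  by (rule finite_subset[of _ "A \<rightarrow>\<^sub>E {..M}"]) (auto simp: labellings_def intro: finite_PiE)

text \<open>Once the labels of \<open>e\<close>, \<open>a\<close>, \<open>b\<close> are fixed, a
  labelling is an arbitrary pair of labellings of the two disjoint subbranches; restriction and
  gluing are mutually inverse.\<close>

lemma card_labellings_root:
  assumes "branch e A \<tau> s" "k \<le> M"
  shows "card {w \<in> labellings R M A \<tau>. w e = k} = count_shape R M s k"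
  using assms
proof (induction arbitrary: k)
  case (branch_Leaf e)
  have "{w \<in> labellings R M {e} {}. w e = k} = {\<lambda>x\<in>{e}. k}"
    using branch_Leaf by (auto simp: labellings_def PiE_iff extensional_def fun_eq_iff)
  then show ?case by simp
next
  case (branch_Node a A \<tau> l b B \<sigma> r e)
  let ?E = "insert e (A \<union> B)"
  let ?T = "insert {#e, a, b#} (\<tau> \<union> \<sigma>)"
  let ?S = "{(i, j). i \<le> M \<and> j \<le> M \<and> R {#k, i, j#}}"
  let ?WA = "\<lambda>i. {w \<in> labellings R M A \<tau>. w a = i}"
  let ?WB = "\<lambda>j. {w \<in> labellings R M B \<sigma>. w b = j}"
  let ?W = "{w \<in> labellings R M ?E ?T. w e = k}"
  let ?h = "\<lambda>w. ((w a, w b), (restrict w A, restrict w B))"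
  let ?g = "\<lambda>(p, u, v). \<lambda>x\<in>?E. if x = e then k else if x \<in> A then u x else v x"
  have A: "a \<in> A" "finite A" "\<forall>m\<in>\<tau>. set_mset m \<subseteq> A"
    and B: "b \<in> B" "finite B" "\<forall>m\<in>\<sigma>. set_mset m \<subseteq> B"
    using branch_facts branch_Node.hyps by metis+
  have "bij_betw ?h ?W (SIGMA p:?S. ?WA (fst p) \<times> ?WB (snd p))"
  proof (rule bij_betw_byWitness[where f' = ?g])
    show "\<forall>w\<in>?W. ?g (?h w) = w"
      using branch_Node.hyps by (auto simp: labellings_def PiE_iff extensional_def fun_eq_iff)
    show "\<forall>q\<in>SIGMA p:?S. ?WA (fst p) \<times> ?WB (snd p). ?h (?g q) = q"
    proof
      fix q assume "q \<in> (SIGMA p:?S. ?WA (fst p) \<times> ?WB (snd p))"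
      then obtain i j u v where q: "q = ((i, j), u, v)" "u \<in> ?WA i" "v \<in> ?WB j" by auto
      have "restrict (?g q) A = u" "restrict (?g q) B = v"
        using q branch_Node.hyps by (auto simp: labellings_def PiE_iff extensional_def fun_eq_iff)
      moreover have "?g q a = i" "?g q b = j"
        using q A(1) B(1) branch_Node.hyps by auto
      ultimately show "?h (?g q) = q" using q(1) by simp
    qed
    show "?h ` ?W \<subseteq> (SIGMA p:?S. ?WA (fst p) \<times> ?WB (snd p))"
    proof
      fix q assume "q \<in> ?h ` ?W"
      then obtain w where w: "w \<in> labellings R M ?E ?T" "w e = k" "q = ?h w" by auto
      have "restrict w A \<in> labellings R M A \<tau>" "restrict w B \<in> labellings R M B \<sigma>"
        using w A B by (auto intro!: labellings_restrict[OF _ _ _ w(1)])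
      moreover have "w a \<le> M" "w b \<le> M" "R {#k, w a, w b#}"
        using w A(1) B(1) by (auto simp: labellings_def PiE_iff)
      ultimately show "q \<in> (SIGMA p:?S. ?WA (fst p) \<times> ?WB (snd p))"
        using w(3) A(1) B(1) by simp
    qed
    show "?g ` (SIGMA p:?S. ?WA (fst p) \<times> ?WB (snd p)) \<subseteq> ?W"
    proof
      fix w assume "w \<in> ?g ` (SIGMA p:?S. ?WA (fst p) \<times> ?WB (snd p))"
      then obtain i j u v where w: "w = ?g ((i, j), u, v)" and ij: "R {#k, i, j#}"
        and u: "u \<in> labellings R M A \<tau>" "u a = i" and v: "v \<in> labellings R M B \<sigma>" "v b = j" by auto
      have we: "w e = k" using w by simp
      have wA: "w x = u x" if "x \<in> A" for x using w that branch_Node.hyps by auto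
      have wB: "w x = v x" if "x \<in> B" for x using w that branch_Node.hyps by auto
      have "image_mset w m = image_mset u m" if "m \<in> \<tau>" for m
        using that A(3) wA by (intro image_mset_cong) auto
      moreover have "image_mset w m = image_mset v m" if "m \<in> \<sigma>" for m
        using that B(3) wB by (intro image_mset_cong) auto
      moreover have "image_mset w {#e, a, b#} = {#k, i, j#}"
        using we wA[OF A(1)] wB[OF B(1)] u v by simp
      ultimately have "\<forall>m\<in>?T. R (image_mset w m)"
        using u v ij by (auto simp: labellings_def)
      moreover have "w \<in> ?E \<rightarrow>\<^sub>E {..M}"
      proof
        fix x assume "x \<in> ?E"
        then show "w x \<in> {..M}"
          using we wA wB u v \<open>k \<le> M\<close> by (auto simp: labellings_def PiE_iff)
      qed (simp add: w)
      ultimately show "w \<in> ?W" using we by (simp add: labellings_def)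
    qed
  qed
  then have "card ?W = card (SIGMA p:?S. ?WA (fst p) \<times> ?WB (snd p))"
    by (rule bij_betw_same_card)
  also have "\<dots> = (\<Sum>p\<in>?S. card (?WA (fst p) \<times> ?WB (snd p)))"
    using A B by (intro card_SigmaI finite_pairs) (auto simp: finite_labellings intro!: finite_cartesian_product)
  also have "\<dots> = count_shape R M (Node l r) k"
    unfolding count_shape.simps
    by (rule sum.cong) (auto simp: card_cartesian_product branch_Node.IH)
  finally show ?case .
qed

lemma card_labellings:
  assumes "branch e A \<tau> s"
  shows "card (labellings R M A \<tau>) = (\<Sum>k\<le>M. count_shape R M s k)"
proof -
  have "e \<in> A" "finite A" using branch_facts[OF assms] by auto
  then have "labellings R M A \<tau> = (\<Union>k\<in>{..M}. {w \<in> labellings R M A \<tau>. w e = k})"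
    by (auto simp: labellings_def PiE_iff)
  then have "card (labellings R M A \<tau>) = card (\<Union>k\<in>{..M}. {w \<in> labellings R M A \<tau>. w e = k})"
    by simp
  also have "\<dots> = (\<Sum>k\<le>M. card {w \<in> labellings R M A \<tau>. w e = k})"
    by (rule card_UN_disjoint) (auto simp: finite_labellings \<open>finite A\<close>)
  finally show ?thesis using card_labellings_root[OF assms] by simp
qed

text \<open>Guarantees that each coordinate is constrained. If no end of \<open>e\<close> is
  internal, its ends are leaves whose only edge is \<open>e\<close>, so no walk starting at
  \<open>e\<close> meets another edge.\<close>

lemma single_edge_or_internal:
  assumes "graph13 G" "e \<in> edges G"
  shows "e \<in> single_edge_components G \<or> (\<exists>v\<in>internal_nodes G. e \<in># incident_edges G v)"
proof (rule disjCI)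
  assume no: "\<not> (\<exists>v\<in>internal_nodes G. e \<in># incident_edges G v)"
  have fin: "finite_mgraph G" using assms by (simp add: graph13_def)
  have only: "f = e" if f: "f \<in> edges G" "x \<in># ends G f" and x: "x \<in># ends G e" for f x
  proof -
    have "x \<in> nodes G" using fin f by (auto simp: finite_mgraph_def)
    moreover have ex: "e \<in># incident_edges G x" using x assms(2) by (simp add: mem_incident_edges[OF fin])
    ultimately have "node_degree G x = 1"
      using no assms(1) by (auto simp: graph13_def internal_nodes_def)
    then obtain g where "incident_edges G x = {#g#}"
      unfolding node_degree_def using size_1_singleton_mset by blast
    moreover have "f \<in># incident_edges G x" using f by (simp add: mem_incident_edges[OF fin])
    ultimately show ?thesis using ex by simp
  qed
  have closed: "v \<in># ends G e" if "(u, v) \<in> (adjacency G)\<^sup>*" "u \<in># ends G e" for u v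
    using that
  proof (induction rule: rtrancl_induct)
    case (step p q)
    then obtain f where "f \<in> edges G" "ends G f = {#p, q#}" by (auto simp: adjacency_def)
    with only[of f p] step show ?case by auto
  qed
  have "ends G e \<noteq> {#}" using fin assms(2) by (auto simp: finite_mgraph_def)
  then obtain u where "u \<in># ends G e" by blast
  then have "component_edges G e = {e}"
    using only closed assms(2) unfolding component_edges_def by blast
  with assms(2) show "e \<in> single_edge_components G" by (simp add: single_edge_components_def)
qed

lemma internal_incident_triple:
  assumes "v \<in> internal_nodes G"
  obtains a b c where "incident_edges G v = {#a, b, c#}"
proof -
  have size: "size (incident_edges G v) = 3"
    using assms by (simp add: internal_nodes_def node_degree_def)
  then obtain a m where m: "incident_edges G v = add_mset a m"
    using size_eq_Suc_imp_eq_union[of "incident_edges G v" 2] by auto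
  with size have "size m = 2" by simp
  then obtain b c where "m = {#b, c#}" using size_2_doubleton_mset by blast
  with m that show ?thesis by simp
qed

lemma incident_triple_edges:
  assumes "graph13 G" "incident_edges G v = {#a, b, c#}"
  shows "a \<in> edges G" "b \<in> edges G" "c \<in> edges G"
  using mem_incident_edges[of G _ v] assms by (auto simp: graph13_def)

text \<open>At a node, adding two triangle inequalities gives nonnegativity, and the third bounds
  twice the coordinate by the total.\<close>

lemma polytope_P_bounds:
  assumes "graph13 G" "w \<in> polytope_P G" "e \<in> edges G"
  shows "0 \<le> w e \<and> w e \<le> 1 / 2"
proof -
  consider "e \<in> single_edge_components G" | v where "v \<in> internal_nodes G" "e \<in># incident_edges G v"
    using single_edge_or_internal[OF assms(1,3)] by blast
  then show ?thesis
  proof cases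
    case 1
    with assms(2) show ?thesis by (auto simp: polytope_P_def)
  next
    case 2
    obtain a b c where inc: "incident_edges G v = {#a, b, c#}" using internal_incident_triple[OF 2(1)] .
    with 2 assms(2) have "w a \<le> w b + w c \<and> w b \<le> w a + w c \<and> w c \<le> w a + w b \<and> w a + w b + w c \<le> 1"
      unfolding polytope_P_def by blast
    moreover from inc 2(2) have "e = a \<or> e = b \<or> e = c" by auto
    ultimately show ?thesis by auto
  qed
qed

lemma polytope_Q_bounds:
  assumes "graph13 G" "(w, z) \<in> polytope_Q G" "e \<in> edges G"
  shows "0 \<le> w e \<and> w e \<le> 1"
proof -
  consider "e \<in> single_edge_components G" | v where "v \<in> internal_nodes G" "e \<in># incident_edges G v"
    using single_edge_or_internal[OF assms(1,3)] by blast
  then show ?thesis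
  proof cases
    case 1
    with assms(2) show ?thesis by (auto simp: polytope_Q_def)
  next
    case 2
    obtain a b c where inc: "incident_edges G v = {#a, b, c#}" using internal_incident_triple[OF 2(1)] .
    with 2 assms(2) have "w a \<le> w b + w c \<and> w b \<le> w a + w c \<and> w c \<le> w a + w b \<and> w a + w b + w c = 2 * z v \<and> z v \<le> 1"
      unfolding polytope_Q_def by blast
    moreover from inc 2(2) have "e = a \<or> e = b \<or> e = c" by auto
    ultimately show ?thesis by auto
  qed
qed

section \<open>Lattice points of the dilated polytopes as natural-number labellings\<close>

abbreviation real_on :: "'a set \<Rightarrow> ('a \<Rightarrow> nat) \<Rightarrow> 'a \<Rightarrow> real" where
  "real_on A w \<equiv> \<lambda>x\<in>A. real (w x)"

lemma inj_on_real_on: "inj_on (real_on A) (A \<rightarrow>\<^sub>E B)"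
proof (rule inj_onI)
  fix u v assume uv: "u \<in> A \<rightarrow>\<^sub>E B" "v \<in> A \<rightarrow>\<^sub>E B" "real_on A u = real_on A v"
  show "u = v"
  proof (rule PiE_ext[OF uv(1,2)])
    fix x assume "x \<in> A"
    with fun_cong[OF uv(3), of x] show "u x = v x" by simp
  qed
qed

lemma lattice_point_nat:
  assumes "x \<in> A \<rightarrow>\<^sub>E \<int>" "\<And>e. e \<in> A \<Longrightarrow> 0 \<le> x e"
  obtains w where "w \<in> extensional A" "x = real_on A w"
proof -
  define w where "w = (\<lambda>e\<in>A. nat \<lfloor>x e\<rfloor>)"
  have "x e = real (w e)" if "e \<in> A" for e
    using assms that by (auto simp: w_def PiE_iff Ints_def)
  with assms(1) have "x = real_on A w"
    by (auto simp: PiE_iff extensional_def fun_eq_iff)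
  moreover have "w \<in> extensional A" by (simp add: w_def)
  ultimately show ?thesis using that by blast
qed

lemma ehrhart_P_labellings:
  assumes G: "graph13 G"
  shows "ehrhart_P G t = card (labellings (tri_P t) (t div 2) (edges G) (incident_edges G ` internal_nodes G))"
proof -
  let ?L = "labellings (tri_P t) (t div 2) (edges G) (incident_edges G ` internal_nodes G)"
  have "scale_on (edges G) (real t) ` polytope_P G \<inter> (edges G \<rightarrow>\<^sub>E \<int>) = real_on (edges G) ` ?L"
  proof (intro equalityI subsetI)
    fix x assume x: "x \<in> scale_on (edges G) (real t) ` polytope_P G \<inter> (edges G \<rightarrow>\<^sub>E \<int>)"
    then obtain y where y: "y \<in> polytope_P G" "x = scale_on (edges G) (real t) y" by blast
    have xe: "x e = real t * y e" if "e \<in> edges G" for e using that y by (simp add: scale_on_def)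
    have bd: "0 \<le> x e \<and> x e \<le> real t / 2" if "e \<in> edges G" for e
      using polytope_P_bounds[OF G y(1) that] mult_left_mono[of "y e" "1/2" "real t"] by (simp add: xe[OF that])
    obtain w where w: "w \<in> extensional (edges G)" "x = real_on (edges G) w"
      using lattice_point_nat[of x "edges G"] x bd by blast
    have we: "real (w e) = real t * y e" if "e \<in> edges G" for e using xe[OF that] w that by simp
    have "tri_P t (image_mset w (incident_edges G v))" if v: "v \<in> internal_nodes G" for v
    proof -
      obtain a b c where inc: "incident_edges G v = {#a, b, c#}" using internal_incident_triple[OF v] .
      note abc = incident_triple_edges[OF G inc]
      have "y a \<le> y b + y c" "y b \<le> y a + y c" "y c \<le> y a + y b" "y a + y b + y c \<le> 1"
        using y(1) v inc unfolding polytope_P_def by blast+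
      from this[THEN mult_left_mono, of "real t"]
      have "real (w a) \<le> real (w b) + real (w c)" "real (w b) \<le> real (w a) + real (w c)"
        "real (w c) \<le> real (w a) + real (w b)" "real (w a) + real (w b) + real (w c) \<le> real t"
        using abc by (simp_all add: we distrib_left)
      then show ?thesis unfolding inc image_mset_add_mset image_mset_empty tri_P_triple by linarith
    qed
    moreover have "w e \<le> t div 2" if "e \<in> edges G" for e
    proof -
      have "real (w e) \<le> real t / 2" using bd[OF that] w that by simp
      then show ?thesis by linarith
    qed
    ultimately have "w \<in> ?L" using w by (auto simp: labellings_def PiE_iff)
    with w show "x \<in> real_on (edges G) ` ?L" by blast
  next
    fix x assume "x \<in> real_on (edges G) ` ?L"
    then obtain w where w: "w \<in> ?L" "x = real_on (edges G) w" by blast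
    have bd: "w e \<le> t div 2" if "e \<in> edges G" for e using w that by (auto simp: labellings_def PiE_iff)
    define y where "y = (\<lambda>e\<in>edges G. real (w e) / real t)"
    \<comment> \<open>For \<open>t = 0\<close> the bound forces \<open>w\<close> to vanish on the
      edges, so division by zero does no harm here.\<close>
    have "x = scale_on (edges G) (real t) y"
      using bd by (auto simp: w(2) scale_on_def y_def fun_eq_iff)
    moreover have "y \<in> polytope_P G"
    proof -
      have "y a \<le> y b + y c \<and> y b \<le> y a + y c \<and> y c \<le> y a + y b \<and> y a + y b + y c \<le> 1"
        if v: "v \<in> internal_nodes G" and inc: "incident_edges G v = {#a, b, c#}" for v a b c
      proof -
        have "tri_P t (image_mset w (incident_edges G v))"
          using w(1) v by (auto simp: labellings_def)
        then have "w a \<le> w b + w c" "w b \<le> w a + w c" "w c \<le> w a + w b" "w a + w b + w c \<le> t"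
          unfolding inc image_mset_add_mset image_mset_empty tri_P_triple by auto
        then show ?thesis
          using incident_triple_edges[OF G inc]
          by (auto simp: y_def add_divide_distrib[symmetric] divide_right_mono divide_le_eq_1)
      qed
      moreover have "0 \<le> y e \<and> y e \<le> 1 / 2" if "e \<in> edges G" for e
      proof -
        have "2 * w e \<le> t" using bd[OF that] by linarith
        then have "real (w e) \<le> real t / 2" by linarith
        then have "real (w e) / real t \<le> real t / 2 / real t" by (rule divide_right_mono) simp
        also have "\<dots> \<le> 1 / 2" by simp
        finally show ?thesis using that by (simp add: y_def)
      qed
      ultimately show ?thesis
        unfolding polytope_P_def by (auto simp: y_def single_edge_components_def)
    qed
    ultimately have "x \<in> scale_on (edges G) (real t) ` polytope_P G" by blast
    moreover have "x \<in> edges G \<rightarrow>\<^sub>E \<int>" by (simp add: w(2))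
    ultimately show "x \<in> scale_on (edges G) (real t) ` polytope_P G \<inter> (edges G \<rightarrow>\<^sub>E \<int>)" ..
  qed
  moreover have "inj_on (real_on (edges G)) ?L"
    by (rule inj_on_subset[OF inj_on_real_on[of "edges G" "{..t div 2}"]]) (auto simp: labellings_def)
  ultimately show ?thesis unfolding ehrhart_P_def by (simp add: card_image)
qed

lemma ehrhart_Q_labellings:
  assumes G: "graph13 G"
  shows "ehrhart_Q G t = card (labellings (tri_Q t) t (edges G) (incident_edges G ` internal_nodes G))"
proof -
  let ?L = "labellings (tri_Q t) t (edges G) (incident_edges G ` internal_nodes G)"
  \<comment> \<open>The node coordinates are determined by the edge labels; the integer division is
    exact since \<open>tri_Q\<close> makes the total even.\<close>
  define zz where "zz w = (\<lambda>v\<in>internal_nodes G. real (\<Sum>\<^sub># (image_mset w (incident_edges G v)) div 2))"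
    for w :: "'b \<Rightarrow> nat"
  let ?h = "\<lambda>w. (real_on (edges G) w, zz w)"
  let ?P = "map_prod (scale_on (edges G) (real t)) (scale_on (internal_nodes G) (real t)) ` polytope_Q G
      \<inter> ((edges G \<rightarrow>\<^sub>E \<int>) \<times> (internal_nodes G \<rightarrow>\<^sub>E \<int>))"
  have "?P = ?h ` ?L"
  proof (intro equalityI subsetI)
    fix q assume "q \<in> ?P"
    then obtain y u x z where q: "q = (x, z)" and y: "(y, u) \<in> polytope_Q G" "x = scale_on (edges G) (real t) y"
      "z = scale_on (internal_nodes G) (real t) u"
      and x: "x \<in> edges G \<rightarrow>\<^sub>E \<int>" "z \<in> internal_nodes G \<rightarrow>\<^sub>E \<int>" by auto
    have xe: "x e = real t * y e" if "e \<in> edges G" for e using that y by (simp add: scale_on_def)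
    have bd: "0 \<le> x e \<and> x e \<le> real t" if "e \<in> edges G" for e
      using polytope_Q_bounds[OF G y(1) that] mult_left_mono[of "y e" 1 "real t"] by (simp add: xe[OF that])
    obtain w where w: "w \<in> extensional (edges G)" "x = real_on (edges G) w"
      using lattice_point_nat[of x "edges G"] x(1) bd by blast
    have we: "real (w e) = real t * y e" if "e \<in> edges G" for e using xe[OF that] w that by simp
    have node: "tri_Q t (image_mset w (incident_edges G v)) \<and> z v = zz w v" if v: "v \<in> internal_nodes G" for v
    proof -
      obtain a b c where inc: "incident_edges G v = {#a, b, c#}" using internal_incident_triple[OF v] .
      note abc = incident_triple_edges[OF G inc]
      have ineq: "y a \<le> y b + y c" "y b \<le> y a + y c" "y c \<le> y a + y b" "u v \<le> 1"
        and eq: "y a + y b + y c = 2 * u v"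
        using y(1) v inc unfolding polytope_Q_def by blast+
      have zv: "z v = real t * u v" using y v by (simp add: scale_on_def)
      from ineq[THEN mult_left_mono, of "real t"]
      have le: "real (w a) \<le> real (w b) + real (w c)" "real (w b) \<le> real (w a) + real (w c)"
        "real (w c) \<le> real (w a) + real (w b)" "z v \<le> real t"
        using abc zv by (simp_all add: we distrib_left)
      have sum: "real (w a) + real (w b) + real (w c) = 2 * z v"
        using abc zv arg_cong[OF eq, of "\<lambda>x. real t * x"] by (simp add: we distrib_left)
      \<comment> \<open>Integrality of \<open>z v\<close> is what forces the total at
        \<open>v\<close> to be even.\<close>
      obtain i where i: "z v = of_int i" using x(2) v by (auto simp: PiE_iff elim!: Ints_cases)
      have "int (w a + w b + w c) = 2 * i" using sum i by linarith
      then have "w a + w b + w c = 2 * nat i" by linarith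
      moreover from this have "z v = real (nat i)" using sum by linarith
      ultimately show ?thesis
        using le v unfolding inc image_mset_add_mset image_mset_empty tri_Q_triple zz_def
        by (auto simp: inc)
    qed
    have "w e \<le> t" if "e \<in> edges G" for e
      using bd[OF that] w that by simp
    with node have "w \<in> ?L" using w by (auto simp: labellings_def PiE_iff)
    moreover have "z = zz w"
      using node x(2) by (auto simp: zz_def PiE_iff extensional_def fun_eq_iff)
    ultimately show "q \<in> ?h ` ?L" using q w by blast
  next
    fix q assume "q \<in> ?h ` ?L"
    then obtain w where w: "w \<in> ?L" "q = ?h w" by blast
    have bd: "w e \<le> t" if "e \<in> edges G" for e using w that by (auto simp: labellings_def PiE_iff)
    define y where "y = (\<lambda>e\<in>edges G. real (w e) / real t)"
    define u where "u = (\<lambda>v\<in>internal_nodes G. zz w v / real t)"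
    have node: "w a \<le> w b + w c \<and> w b \<le> w a + w c \<and> w c \<le> w a + w b \<and> w a + w b + w c \<le> 2 * t
        \<and> real (w a) + real (w b) + real (w c) = 2 * zz w v"
      if v: "v \<in> internal_nodes G" and inc: "incident_edges G v = {#a, b, c#}" for v a b c
    proof -
      have "tri_Q t (image_mset w (incident_edges G v))"
        using w(1) v by (auto simp: labellings_def)
      then have "w a \<le> w b + w c" "w b \<le> w a + w c" "w c \<le> w a + w b" "w a + w b + w c \<le> 2 * t"
        and ev: "even (w a + w b + w c)"
        unfolding inc image_mset_add_mset image_mset_empty tri_Q_triple by auto
      moreover obtain i where i: "w a + w b + w c = 2 * i" using ev by (rule evenE)
      then have "zz w v = real i" using v by (simp add: zz_def inc flip: add.assoc)
      moreover have "real (w a) + real (w b) + real (w c) = 2 * real i"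
        using arg_cong[OF i, of real] by simp
      ultimately show ?thesis by simp
    qed
    have "real_on (edges G) w = scale_on (edges G) (real t) y"
      using bd by (auto simp: scale_on_def y_def fun_eq_iff)
    moreover have "zz w v \<le> real t" if v: "v \<in> internal_nodes G" for v
    proof -
      obtain a b c where inc: "incident_edges G v = {#a, b, c#}" using internal_incident_triple[OF v] .
      from node[OF v inc] show ?thesis by linarith
    qed
    then have zt: "0 \<le> zz w v \<and> zz w v \<le> real t" if "v \<in> internal_nodes G" for v
      using that by (simp add: zz_def)
    then have "zz w = scale_on (internal_nodes G) (real t) u"
      by (force simp: scale_on_def u_def fun_eq_iff zz_def)
    moreover have "(y, u) \<in> polytope_Q G"
    proof -
      have "y a \<le> y b + y c \<and> y b \<le> y a + y c \<and> y c \<le> y a + y b \<and> y a + y b + y c = 2 * u v \<and> u v \<le> 1"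
        if v: "v \<in> internal_nodes G" and inc: "incident_edges G v = {#a, b, c#}" for v a b c
        using node[OF v inc] zt[OF v] v incident_triple_edges[OF G inc]
        by (auto simp: y_def u_def add_divide_distrib[symmetric] divide_right_mono divide_le_eq_1)
      moreover have "0 \<le> y e \<and> y e \<le> 1" if "e \<in> edges G" for e
        using bd[OF that] that by (auto simp: y_def divide_le_eq_1)
      ultimately show ?thesis
        unfolding polytope_Q_def by (auto simp: y_def u_def single_edge_components_def)
    qed
    ultimately have "q \<in> map_prod (scale_on (edges G) (real t)) (scale_on (internal_nodes G) (real t)) ` polytope_Q G"
      using w(2) by force
    moreover have "zz w \<in> internal_nodes G \<rightarrow>\<^sub>E \<int>" by (auto simp: zz_def)
    ultimately show "q \<in> ?P" using w(2) by auto
  qed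
  moreover have "inj_on (real_on (edges G)) ?L"
    by (rule inj_on_subset[OF inj_on_real_on[of "edges G" "{..t}"]]) (auto simp: labellings_def)
  then have "inj_on ?h ?L" by (auto simp: inj_on_def)
  ultimately show ?thesis unfolding ehrhart_Q_def by (simp add: card_image)
qed

section \<open>The two minimal periods\<close>

lemma real_poly_eq_on_odd:
  fixes p q :: "real poly"
  assumes "\<And>m. poly p (real (2 * m + 1)) = poly q (real (2 * m + 1))"
  shows "p = q"
proof -
  have "range (\<lambda>m. real (2 * m + 1)) \<subseteq> {x. poly (p - q) x = 0}" using assms by auto
  moreover have "infinite (range (\<lambda>m::nat. real (2 * m + 1)))"
    by (rule range_inj_infinite) (auto simp: inj_on_def)
  ultimately have "infinite {x. poly (p - q) x = 0}" using finite_subset by blast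
  then show ?thesis using poly_roots_finite[of "p - q"] by auto
qed

theorem theorem1:
  fixes T :: "('v, 'e) mgraph"
  assumes "tree13 T"
  shows "has_period (ehrhart_P T) 2 \<and> has_period (ehrhart_Q T) 1"
proof -
  interpret tree13_graph T by unfold_locales (rule assms)
  have G: "graph13 T" using assms by (simp add: tree13_def)
  obtain e s where br: "branch e (edges T) (incident_edges T ` internal_nodes T) s"
    using branch_tree by blast
  have P: "ehrhart_P T t = (\<Sum>k\<le>t div 2. count_P t s k)"
    and Q: "ehrhart_Q T t = (\<Sum>k\<le>t. count_Q t s k)" for t
    using ehrhart_P_labellings[OF G] ehrhart_Q_labellings[OF G] card_labellings[OF br] by auto
  obtain q where q: "\<And>t. real (ehrhart_Q T t) = poly q (real t)"
    using count_Q_polyfun[of s] sum_polyfun_poly[of _ "\<lambda>t. count_Q t s"] unfolding Q by metis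
  obtain p where p: "\<And>m. real (ehrhart_P T (2 * m)) = poly p (real m)"
    using count_P_even_polyfun[of s] sum_polyfun_poly[of _ "\<lambda>m. count_P (2 * m) s"] unfolding P by fastforce
  define N :: real where "N = 2 ^ Suc (internal_size s)"
  have N: "N > 1" unfolding N_def by (rule one_less_power) auto
  have odd: "real (ehrhart_P T t) = poly (smult (1 / N) q) (real t)" if "t = 2 * m + 1" for t m
  proof -
    have "real (ehrhart_Q T t) = N * real (ehrhart_P T t)"
      unfolding P Q total_Q_odd[OF that] N_def by simp
    with N show ?thesis by (simp add: q[symmetric])
  qed
  have "quasi_polynomial_mod 1 (ehrhart_Q T)"
    unfolding quasi_polynomial_mod_def using q by (auto intro!: exI[of _ "\<lambda>_. q"])
  then have hQ: "has_period (ehrhart_Q T) 1"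
    by (auto simp: has_period_def quasi_polynomial_mod_def)
  have "quasi_polynomial_mod 2 (ehrhart_P T)"
    unfolding quasi_polynomial_mod_def
  \<comment> \<open>For even \<open>t\<close> the polynomial \<open>p\<close> has argument
    \<open>t / 2\<close>, hence the composition; for odd \<open>t\<close> the polynomial of the
    other polytope is divided by \<open>N\<close>.\<close>
  proof (intro conjI exI[of _ "\<lambda>j. if j = 0 then pcompose p [:0, 1/2:] else smult (1 / N) q"] allI impI)
    fix j t :: nat assume j: "j < 2" "t mod 2 = j"
    define m where "m = t div 2"
    consider "j = 0" "t = 2 * m" | "j = 1" "t = 2 * m + 1"
      using j unfolding m_def by (metis One_nat_def less_2_cases mult_div_mod_eq add_0_right)
    then show "real (ehrhart_P T t) = poly (if j = 0 then pcompose p [:0, 1/2:] else smult (1 / N) q) (real t)"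
    proof cases
      case 1
      then show ?thesis using p[of m] by (simp add: poly_pcompose)
    next
      case 2
      then show ?thesis using odd[of t m] by simp
    qed
  qed simp
  moreover have "\<not> quasi_polynomial_mod 1 (ehrhart_P T)"
  proof
    assume "quasi_polynomial_mod 1 (ehrhart_P T)"
    then obtain p' where p': "\<And>t. real (ehrhart_P T t) = poly p' (real t)"
      unfolding quasi_polynomial_mod_def by auto
    \<comment> \<open>Agreement at all odd \<open>t\<close> identifies the polynomials. At
      \<open>t = 0\<close>, where both counts are 1, this would give \<open>1 = 1 / N\<close>,
      against \<open>N > 1\<close>.\<close>
    have "p' = smult (1 / N) q"
      by (rule real_poly_eq_on_odd) (metis odd p')
    then have "real (ehrhart_P T 0) = real (ehrhart_Q T 0) / N"
      using p'[of 0] q[of 0] by simp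
    with N show False by (simp add: P Q count_zero)
  qed
  then have "2 \<le> k" if "quasi_polynomial_mod k (ehrhart_P T)" for k
    using that by (cases "k = 0 \<or> k = 1") (auto simp: quasi_polynomial_mod_def)
  ultimately have "has_period (ehrhart_P T) 2" by (simp add: has_period_def)
  with hQ show ?thesis by simp
qed

end
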